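(* The set of $U_1\in\Omega_{rev}$ for which the metric of revolution $ds^2=U_1(q_1)(dq_1^2+dq_2^2)$ on $\mathbb R^2/\mathbb Z^2$ is nondegenerate is dense in $\Omega_{rev}$ in the Whitney $C^\infty$-topology (the topology induced from $C^\infty(\mathbb R/\mathbb Z)$).
   Context: **The set $\Omega_{rev}$.** $\Omega_{rev}$ is the set of positive functions $U_1\in C^\infty(\mathbb R)$ with $U_1(q+1)=U_1(q)$ for all $q$, having exactly one minimum and one maximum in $[0,1)$, both nondegenerate, and with $U_1''\neq0$ at every critical point of $U_1$ (so these two points are the only critical points in $[0,1)$). On the compact manifold $\mathbb R/\mathbb Z$ the Whitney $C^\infty$-topology is the topology of uniform convergence of all derivatives. **Notation.** For $U_1\in\Omega_{rev}$ let $c_1=\max U_1=U_1(M_1)$, $c_2=\min U_1=U_1(m_1)$, and for $c\in[0,c_1]$ let $$F_1(c)=\int_{\{q\in[0,1]:U_1(q)\ge c\}}(U_1(q)-c)^{1/2}dq,\qquad F_2(c)=c^{1/2}.$$ $F_1$ is $C^\infty$ on $[0,c_2)\cup(c_2,c_1]$ (one-sided derivatives at the ends). The curvature of the plane curve $\gamma=(F_1(c),F_2(c))$ is $\kappa(c)=\frac{F_2''F_1'-F_1''F_2'}{((F_1')^2+(F_2')^2)^{3/2}}(c)$. **Typical numbers.** A real number $\alpha$ is typical if there exist $\tau>0$ and $\delta(\alpha)>0$ such that $|k_1+\alpha k_2|\ge\frac{\delta(\alpha)}{|k_2|\log(1+|k_2|)^\tau}$ for all $k_1,k_2\in\mathbb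 Z$ with $k_2\ne0$. **Nondegenerate metrics of revolution.** The metric $ds^2=U_1(q_1)(dq_1^2+dq_2^2)$ on $\mathbb R^2/\mathbb Z^2$ is nondegenerate if $U_1\in\Omega_{rev}$ and: 1. $\kappa$ has finitely many zeros on $(c_2,c_1]$, each of first order; 2. if $\kappa(\tilde c)=0$, then $F_2'(\tilde c)/F_1'(\tilde c)$ is typical; 3. $F_2'(c_1)/F_1'(c_1)=\frac{c_1^{-1/2}}{-2\pi(-2U_1''(M_1))^{-1/2}}$ is typical; 4. $F_2(c_2)/F_1(c_2)$ is typical. *)

theory Defs
  imports "HOL-Analysis.Analysis"
begin

subsection \<open>Smooth functions on the circle and their topology\<close>

text \<open>Functions on \<open>\<real>/\<int>\<close> are represented by their 1-periodic lifts to \<open>\<real>\<close>.\<close>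

definition smooth_periodic :: "(real \<Rightarrow> real) set" where
  "smooth_periodic =
     {U. (\<forall>k. (deriv ^^ k) U differentiable_on UNIV) \<and> (\<forall>q. U (q + 1) = U q)}"

definition Cn_near :: "nat \<Rightarrow> real \<Rightarrow> (real \<Rightarrow> real) \<Rightarrow> (real \<Rightarrow> real) \<Rightarrow> bool" where
  "Cn_near n e U V \<longleftrightarrow> (\<forall>k\<le>n. \<forall>q. \<bar>(deriv ^^ k) V q - (deriv ^^ k) U q\<bar> < e)"

definition whitney_topology :: "(real \<Rightarrow> real) topology" where
  "whitney_topology = topology (\<lambda>S. S \<subseteq> smooth_periodic \<and>
     (\<forall>U\<in>S. \<exists>n. \<exists>e>0. \<forall>V\<in>smooth_periodic. Cn_near n e U V \<longrightarrow> V \<in> S))"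

lemma Cn_near_mono: "Cn_near n e U V \<Longrightarrow> m \<le> n \<Longrightarrow> e \<le> d \<Longrightarrow> Cn_near m d U V"
  unfolding Cn_near_def by (meson order_trans less_le_trans)

lemma openin_whitney_topology:
  "openin whitney_topology S \<longleftrightarrow> S \<subseteq> smooth_periodic \<and>
     (\<forall>U\<in>S. \<exists>n. \<exists>e>0. \<forall>V\<in>smooth_periodic. Cn_near n e U V \<longrightarrow> V \<in> S)"
proof -
  let ?N = "\<lambda>S U. \<exists>n. \<exists>e>0. \<forall>V\<in>smooth_periodic. Cn_near n e U V \<longrightarrow> V \<in> S"
  have inter: "?N (S \<inter> T) U" if "?N S U" "?N T U" for S T U
  proof -
    obtain n e where S: "e > 0" "\<forall>V\<in>smooth_periodic. Cn_near n e U V \<longrightarrow> V \<in> S"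
      using \<open>?N S U\<close> by auto
    obtain m d where T: "d > 0" "\<forall>V\<in>smooth_periodic. Cn_near m d U V \<longrightarrow> V \<in> T"
      using \<open>?N T U\<close> by auto
    have "min e d > 0" using S(1) T(1) by simp
    moreover have "\<forall>V\<in>smooth_periodic. Cn_near (max n m) (min e d) U V \<longrightarrow> V \<in> S \<inter> T"
      using S(2) T(2)
      by (meson Cn_near_mono IntI max.cobounded1 max.cobounded2 min.cobounded1 min.cobounded2)
    ultimately show ?thesis by blast
  qed
  have union: "?N (\<Union>K) U" if "S \<in> K" "?N S U" for K S U
    using that by blast
  have "istopology (\<lambda>S. S \<subseteq> smooth_periodic \<and> (\<forall>U\<in>S. ?N S U))"
    unfolding istopology_def
  proof (intro conjI allI impI)
    fix S T
    assume ST: "S \<subseteq> smooth_periodic \<and> (\<forall>U\<in>S. ?N S U)" "T \<subseteq> smooth_periodic \<and> (\<forall>U\<in>T. ?N T U)"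
    show "S \<inter> T \<subseteq> smooth_periodic" using ST by blast
    show "\<forall>U\<in>S \<inter> T. ?N (S \<inter> T) U"
    proof
      fix U assume "U \<in> S \<inter> T"
      then show "?N (S \<inter> T) U" using ST by (intro inter) simp_all
    qed
  next
    fix K
    assume K: "\<forall>S\<in>K. S \<subseteq> smooth_periodic \<and> (\<forall>U\<in>S. ?N S U)"
    show "\<Union>K \<subseteq> smooth_periodic" using K by blast
    show "\<forall>U\<in>\<Union>K. ?N (\<Union>K) U"
    proof
      fix U assume "U \<in> \<Union>K"
      then obtain S where "S \<in> K" "U \<in> S" by blast
      then show "?N (\<Union>K) U" using K by (intro union[of S]) simp_all
    qed
  qed
  then show ?thesis
    unfolding whitney_topology_def by (simp add: topology_inverse')
qed

lemma topspace_whitney_topology [simp]: "topspace whitney_topology = smooth_periodic"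
proof
  show "topspace whitney_topology \<subseteq> smooth_periodic"
    using openin_topspace[of whitney_topology] unfolding openin_whitney_topology by blast
  have "openin whitney_topology smooth_periodic"
    unfolding openin_whitney_topology by (auto intro: exI[of _ "1::real"])
  then show "smooth_periodic \<subseteq> topspace whitney_topology"
    by (rule openin_subset)
qed


subsection \<open>The set \<open>\<Omega>\<^sub>r\<^sub>e\<^sub>v\<close>\<close>

definition local_min :: "(real \<Rightarrow> real) \<Rightarrow> real \<Rightarrow> bool" where
  "local_min U q \<longleftrightarrow> (\<forall>\<^sub>F x in nhds q. U q \<le> U x)"

definition local_max :: "(real \<Rightarrow> real) \<Rightarrow> real \<Rightarrow> bool" where
  "local_max U q \<longleftrightarrow> (\<forall>\<^sub>F x in nhds q. U x \<le> U q)"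

text \<open>Minima and maxima are local ones, so that the two extrema in \<open>[0,1)\<close> are the only
  critical points there. Their nondegeneracy is part of the last condition, since every
  local extremum is a critical point.\<close>

definition Omega_rev :: "(real \<Rightarrow> real) set" where
  "Omega_rev = {U \<in> smooth_periodic.
     (\<forall>q. U q > 0) \<and>
     (\<exists>!m. m \<in> {0..<1} \<and> local_min U m) \<and>
     (\<exists>!M. M \<in> {0..<1} \<and> local_max U M) \<and>
     (\<forall>q. deriv U q = 0 \<longrightarrow> deriv (deriv U) q \<noteq> 0)}"


subsection \<open>The curve \<open>\<gamma> = (F\<^sub>1, F\<^sub>2)\<close> and its curvature\<close>

definition c_max :: "(real \<Rightarrow> real) \<Rightarrow> real" where
  "c_max U = (SUP q. U q)"

definition c_min :: "(real \<Rightarrow> real) \<Rightarrow> real" where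
  "c_min U = (INF q. U q)"

definition F1 :: "(real \<Rightarrow> real) \<Rightarrow> real \<Rightarrow> real" where
  "F1 U c = integral {q \<in> {0..1}. U q \<ge> c} (\<lambda>q. sqrt (U q - c))"

definition F2 :: "real \<Rightarrow> real" where
  "F2 c = sqrt c"

definition curve_domain :: "(real \<Rightarrow> real) \<Rightarrow> real set" where
  "curve_domain U = {0..<c_min U} \<union> {c_min U<..c_max U}"

text \<open>All derivatives in \<open>c\<close> are taken relative to \<open>curve_domain\<close>: two-sided in its
  interior and one-sided at the end points.\<close>

definition dc :: "(real \<Rightarrow> real) \<Rightarrow> (real \<Rightarrow> real) \<Rightarrow> real \<Rightarrow> real" where
  "dc U f c = vector_derivative f (at c within curve_domain U)"

definition kappa :: "(real \<Rightarrow> real) \<Rightarrow> real \<Rightarrow> real" where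
  "kappa U c =
     (dc U (dc U F2) c * dc U (F1 U) c - dc U (dc U (F1 U)) c * dc U F2 c) /
     (((dc U (F1 U) c)\<^sup>2 + (dc U F2 c)\<^sup>2) powr (3 / 2))"


subsection \<open>Nondegenerate metrics of revolution\<close>

definition typical :: "real \<Rightarrow> bool" where
  "typical \<alpha> \<longleftrightarrow> (\<exists>\<tau>>0. \<exists>\<delta>>0. \<forall>k1 k2 :: int. k2 \<noteq> 0 \<longrightarrow>
     \<bar>of_int k1 + \<alpha> * of_int k2\<bar> \<ge>
       \<delta> / (\<bar>of_int k2\<bar> * ln (1 + \<bar>of_int k2\<bar>) powr \<tau>))"

text \<open>The metric \<open>U(q\<^sub>1) (dq\<^sub>1\<^sup>2 + dq\<^sub>2\<^sup>2)\<close>, lifted to \<open>\<real>\<^sup>2\<close>, as a function of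
  the base point and two tangent vectors.\<close>

definition revolution_metric ::
    "(real \<Rightarrow> real) \<Rightarrow> real \<times> real \<Rightarrow> real \<times> real \<Rightarrow> real \<times> real \<Rightarrow> real" where
  "revolution_metric U q v w = U (fst q) * (v \<bullet> w)"

text \<open>At the maximum point \<open>M\<close> of \<open>U\<close>, the left derivative of \<open>F1 U\<close> at \<open>c_max U\<close> equals
  \<open>- pi / sqrt (- 2 U''(M))\<close>. At \<open>c = 0\<close> the derivative of \<open>F2\<close>, hence the curvature,
  does not exist, which is why that point is left out of the condition on slopes at
  zeros of the curvature.\<close>

definition nondegenerate_metric ::
    "(real \<times> real \<Rightarrow> real \<times> real \<Rightarrow> real \<times> real \<Rightarrow> real) \<Rightarrow> bool" where
  "nondegenerate_metric g \<longleftrightarrow> (\<exists>U\<in>Omega_rev. g = revolution_metric U \<and>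
     finite {c \<in> {c_min U<..c_max U}. kappa U c = 0} \<and>
     (\<forall>c\<in>{c_min U<..c_max U}. kappa U c = 0 \<longrightarrow>
        (\<exists>D. D \<noteq> 0 \<and> (kappa U has_real_derivative D) (at c within curve_domain U))) \<and>
     (\<forall>c\<in>curve_domain U - {0}. kappa U c = 0 \<longrightarrow> typical (dc U F2 c / dc U (F1 U) c)) \<and>
     typical (dc U F2 (c_max U) / dc U (F1 U) (c_max U)) \<and>
     typical (F2 (c_min U) / F1 U (c_min U)))"

end

theory Submission
  imports Defs
begin

text \<open>
  Adding a small constant \<open>b > 0\<close> to \<open>U\<close> changes only the zeroth derivative and translates
  \<open>F1\<close>, so for \<open>V = U + b\<close> and \<open>f = F1 U\<close> the zeros of \<open>kappa V\<close> above the minimum of \<open>V\<close> are the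
  points \<open>x + b\<close> with \<open>f' x + 2 (x + b) f'' x = 0\<close>, i.e. \<open>h x = b\<close> for
  \<open>h = - f' / (2 f'') - x\<close>. By Sard's theorem almost every \<open>b\<close> is a regular value of \<open>h\<close>, which
  makes these zeros simple. Along \<open>b = h x\<close> the slope \<open>1 / (2 sqrt (x + b) f' x)\<close> has nonzero
  derivative wherever \<open>h'\<close> is nonzero, and almost every number is typical; hence for almost every
  \<open>b\<close> all slopes are typical. Likewise for the slopes at the two critical values. The zeros do not
  accumulate at the minimum, because there \<open>f'' / \<bar>f'\<bar>\<close> tends to infinity, nor at the maximum,
  where one further value of \<open>b\<close> is excluded. So \<open>U + b\<close> is nondegenerate for almost every \<open>b\<close>.

  For the regularity of \<open>f\<close> up to the maximum, let \<open>y\<close> be the coordinate with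
  \<open>y\<^sup>2 = U M - U\<close>, \<open>\<psi>\<close> its inverse and \<open>r = sqrt (U M - c)\<close>. Substituting \<open>y = r sin t\<close> gives
  \<open>f' c = - T r / 2\<close> and \<open>f'' c = T' r / (4 r)\<close>, where \<open>T r\<close> is the integral of \<open>\<psi>' (r sin t)\<close>
  over \<open>- pi / 2 \<le> t \<le> pi / 2\<close>.
\<close>


subsection \<open>Almost every number is typical\<close>

text \<open>Typical numbers have full measure but form a meagre set, so typical slopes are out of
  reach of a Baire category argument; this is why exceptional shifts are controlled through null
  sets. One real parameter suffices for all zeros of the curvature at once because of a
  cancellation: at fixed \<open>b\<close> the derivative of the slope along the curve vanishes
  exactly where the curvature does. Along \<open>b = h x\<close> only the explicit dependence on
  \<open>b\<close> contributes, and it carries the factor \<open>h'\<close>.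

  The delicate end is the minimum, where \<open>f'\<close> tends to minus infinity from above.
  Differentiating \<open>U' (M + \<psi>) * \<psi>' = - 2 * z\<close> shows that
  \<open>z * \<psi>''\<close> contains a term cubic in \<open>\<psi>'\<close>, positive near the
  minimum, where \<open>\<psi>'\<close> is unbounded. Hence \<open>r * T'\<close> exceeds every
  multiple of \<open>T\<close> up to a constant, and the divergence of \<open>T\<close> absorbs the
  constant. Below the minimum \<open>f'\<close> and \<open>f''\<close> are both negative, so no zero
  arises there.\<close>

lemma summable_inverse_mult_ln_squared:
  "summable (\<lambda>k. 1 / (real (k + 1) * (ln (real (k + 2)))\<^sup>2))"
proof -
  let ?g = "\<lambda>k. 1 / ln (real (k + 2))"
  have "filterlim (\<lambda>k. ln (real (k + 2))) at_top sequentially"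
    by (intro filterlim_compose[OF ln_at_top] filterlim_compose[OF filterlim_real_sequentially]
        filterlim_add_const_nat_at_top)
  then have "?g \<longlonglongrightarrow> 0"
    by (intro tendsto_divide_0[OF tendsto_const] filterlim_at_top_imp_at_infinity)
  \<comment> \<open>The comparison series: since \<open>ln (k + 3) - ln (k + 2)\<close> is at least
    \<open>1 / (k + 3)\<close>, the difference of consecutive values of \<open>1 / ln\<close>
    dominates \<open>1 / ((k + 3) * (ln (k + 3))^2)\<close>.\<close>
  then have sg: "summable (\<lambda>k. ?g k - ?g (Suc k))"
    by (rule telescope_summable')
  have "summable (\<lambda>k. 1 / (real (Suc k + 1) * (ln (real (Suc k + 2)))\<^sup>2))"
  proof (rule summable_comparison_test[OF _ summable_mult[OF sg, of 2]], intro exI allI impI)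
    fix k :: nat
    have l: "0 < ln (real k + 2)" "ln (real k + 2) \<le> ln (real k + 3)" by auto
    have "ln ((real k + 2) / (real k + 3)) \<le> (real k + 2) / (real k + 3) - 1"
      by (rule ln_le_minus_one) (simp add: field_simps)
    then have d: "1 / (real k + 3) \<le> ln (real k + 3) - ln (real k + 2)"
      by (simp add: ln_div field_simps)
    have "1 / ((real k + 2) * (ln (real k + 3))\<^sup>2) \<le> 2 * (1 / (real k + 3)) / (ln (real k + 3))\<^sup>2"
      using l by (simp add: divide_simps)
    also have "\<dots> \<le> 2 * (ln (real k + 3) - ln (real k + 2)) / (ln (real k + 3))\<^sup>2"
      using d by (intro divide_right_mono mult_left_mono) auto
    also have "\<dots> \<le> 2 * (ln (real k + 3) - ln (real k + 2)) / (ln (real k + 2) * ln (real k + 3))"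
      using l by (intro divide_left_mono) (auto simp: power2_eq_square intro!: mult_right_mono)
    also have "\<dots> = 2 * (1 / ln (real k + 2) - 1 / ln (real k + 3))"
      using l by (simp add: field_simps)
    finally have "1 / ((real k + 2) * (ln (real k + 3))\<^sup>2)
        \<le> 2 * (1 / ln (real k + 2) - 1 / ln (real k + 3))" .
    then show "norm (1 / (real (Suc k + 1) * (ln (real (Suc k + 2)))\<^sup>2)) \<le> 2 * (?g k - ?g (Suc k))"
      using l by (simp add: add.commute)
  qed
  then show ?thesis by (subst (asm) summable_Suc_iff)
qed

text \<open>Typicality is negated for the exponent \<open>\<tau> = 2\<close> alone, the first
  integer for which the covering intervals have finite total length. Dividing by \<open>k2\<close>
  and moving its sign into the numerator gives a fraction with denominator
  \<open>k + 1 = \<bar>k2\<bar>\<close>.\<close>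

lemma not_typical_approximation:
  assumes "\<not> typical \<alpha>" "\<delta> > 0"
  obtains j :: int and k :: nat
    where "\<bar>\<alpha> - of_int j / real (k + 1)\<bar> < \<delta> / ((real (k + 1))\<^sup>2 * (ln (real (k + 2)))\<^sup>2)"
proof -
  obtain k1 k2 :: int where k: "k2 \<noteq> 0"
    "\<bar>of_int k1 + \<alpha> * of_int k2\<bar> < \<delta> / (\<bar>of_int k2\<bar> * ln (1 + \<bar>of_int k2\<bar>) powr 2)"
    using assms unfolding typical_def by (metis not_less zero_less_numeral)
  define k where "k = nat \<bar>k2\<bar> - 1"
  have kk: "real (k + 1) = \<bar>real_of_int k2\<bar>" using k(1) by (simp add: k_def of_nat_diff)
  have k2: "real (k + 2) = 1 + \<bar>real_of_int k2\<bar>" using kk by simp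
  have p: "ln (1 + \<bar>real_of_int k2\<bar>) powr 2 = (ln (real (k + 2)))\<^sup>2"
    unfolding k2 using k(1) by (simp add: powr_numeral)
  define j where "j = - sgn k2 * k1"
  have "\<alpha> - of_int j / real (k + 1) = (of_int k1 + \<alpha> * of_int k2) / of_int k2"
    using k(1) unfolding kk j_def by (auto simp: field_simps sgn_if abs_if)
  then have "\<bar>\<alpha> - of_int j / real (k + 1)\<bar> = \<bar>of_int k1 + \<alpha> * of_int k2\<bar> / real (k + 1)"
    by (simp only: abs_divide kk)
  also have "\<dots> < \<delta> / (real (k + 1) * (ln (real (k + 2)))\<^sup>2) / real (k + 1)"
    using k(2) unfolding p kk[symmetric] by (intro divide_strict_right_mono) auto
  finally show ?thesis by (intro that[of j k]) (simp add: power2_eq_square mult_ac)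
qed

text \<open>Borel-Cantelli without a limsup: a number that is not typical violates the bound for
  every \<open>\<delta>\<close>, and the intervals witnessing a violation have total length
  proportional to \<open>\<delta>\<close>. Each denominator \<open>k + 1\<close> contributes a
  multiple of \<open>k + 1\<close> intervals of length \<open>2 * r k\<close>.\<close>

proposition negligible_not_typical: "negligible {\<alpha>. \<not> typical \<alpha>}"
proof -
  let ?b = "\<lambda>k. 1 / (real (k + 1) * (ln (real (k + 2)))\<^sup>2)"
  define B where "B = (\<Sum>k. ?b k)"
  have b0: "?b k \<ge> 0" for k by simp
  have "negligible ({\<alpha>. \<not> typical \<alpha>} \<inter> {- real n..real n})" for n :: nat
    unfolding negligible_outer
  proof (intro allI impI)
    fix e :: real assume "e > 0"
    define N where "N = real (2 * n + 5)"
    have N: "N > 0" by (simp add: N_def)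
    \<comment> \<open>The bound \<open>(ln 2)^2\<close> forces \<open>r k \<le> 1\<close>, which
      confines the numerators to \<open>J k\<close>; the other bound makes the total length
      \<open>2 * N * \<delta> * B\<close> less than \<open>e\<close>.\<close>
    define \<delta> where "\<delta> = min ((ln 2)\<^sup>2) (e / (4 * N * (B + 1)))"
    have B: "B \<ge> 0" unfolding B_def by (intro suminf_nonneg summable_inverse_mult_ln_squared b0)
    have \<delta>: "\<delta> > 0" unfolding \<delta>_def using \<open>e > 0\<close> N B by simp
    define r where "r k = \<delta> / ((real (k + 1))\<^sup>2 * (ln (real (k + 2)))\<^sup>2)" for k :: nat
    have r0: "r k > 0" for k unfolding r_def using \<delta> by (intro divide_pos_pos mult_pos_pos) auto
    have r1: "r k \<le> 1" for k
    proof -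
      have "\<delta> \<le> 1 * (ln 2)\<^sup>2" by (simp add: \<delta>_def)
      also have "\<dots> \<le> (real (k + 1))\<^sup>2 * (ln (real (k + 2)))\<^sup>2"
        by (intro mult_mono power_mono) auto
      finally show ?thesis unfolding r_def using \<delta> by (simp add: divide_le_eq_1)
    qed
    define J where "J k = {- int ((n + 1) * (k + 1))..int ((n + 1) * (k + 1))}" for k
    define E where "E k = (\<Union>j\<in>J k. ball (of_int j / real (k + 1)) (r k))" for k :: nat
    have fJ: "finite (J k)" for k by (simp add: J_def)
    have Em: "E k \<in> sets lborel" for k unfolding E_def by auto
    have sub: "{\<alpha>. \<not> typical \<alpha>} \<inter> {- real n..real n} \<subseteq> (\<Union>k. E k)"
    proof safe
      fix \<alpha> assume \<alpha>: "\<not> typical \<alpha>" "\<alpha> \<in> {- real n..real n}"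
      obtain j k where jk: "\<bar>\<alpha> - of_int j / real (k + 1)\<bar> < r k"
        unfolding r_def by (rule not_typical_approximation[OF \<alpha>(1) \<delta>])
      have "\<bar>of_int j / real (k + 1)\<bar> \<le> real n + 1" using jk \<alpha>(2) r1[of k] by auto
      then have "\<bar>of_int j\<bar> \<le> real ((n + 1) * (k + 1))" by (simp add: field_simps)
      then have "\<bar>j\<bar> \<le> int ((n + 1) * (k + 1))"
        by (metis of_int_abs of_int_le_iff of_int_of_nat_eq)
      then have "j \<in> J k" unfolding J_def by auto
      then show "\<alpha> \<in> (\<Union>k. E k)" unfolding E_def using jk by (auto simp: dist_real_def abs_minus_commute)
    qed
    have meas: "emeasure lborel (E k) \<le> ennreal (2 * N * \<delta> * ?b k)" for k
    proof -
      have "emeasure lborel (E k) \<le> (\<Sum>j\<in>J k. emeasure lborel (ball (of_int j / real (k + 1)) (r k)))"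
        unfolding E_def by (intro emeasure_subadditive_finite fJ) auto
      also have "\<dots> = (\<Sum>j\<in>J k. ennreal (2 * r k))"
        using r0[of k] by (intro sum.cong) (auto simp: ball_eq_greaterThanLessThan)
      also have "\<dots> = ennreal (real (card (J k)) * (2 * r k))"
        using r0[of k] by (simp add: ennreal_mult' ennreal_of_nat_eq_real_of_nat)
      also have "\<dots> \<le> ennreal (2 * N * \<delta> * ?b k)"
      proof (intro ennreal_leI)
        have "real (card (J k)) \<le> N * real (k + 1)"
          unfolding J_def N_def by (simp add: algebra_simps)
        then have "real (card (J k)) * (2 * r k) \<le> N * real (k + 1) * (2 * r k)"
          using r0[of k] by (intro mult_right_mono) auto
        also have "\<dots> = 2 * N * \<delta> * ?b k" unfolding r_def by (simp add: power2_eq_square)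
        finally show "real (card (J k)) * (2 * r k) \<le> 2 * N * \<delta> * ?b k" .
      qed
      finally show ?thesis .
    qed
    have sm: "summable (\<lambda>k. 2 * N * \<delta> * ?b k)" by (intro summable_mult summable_inverse_mult_ln_squared)
    have "emeasure lborel (\<Union>k. E k) \<le> (\<Sum>k. emeasure lborel (E k))"
      using Em by (intro emeasure_subadditive_countably) auto
    also have "\<dots> \<le> (\<Sum>k. ennreal (2 * N * \<delta> * ?b k))" by (intro suminf_le meas) auto
    also have "\<dots> = ennreal (\<Sum>k. 2 * N * \<delta> * ?b k)"
      using N \<delta> by (intro suminf_ennreal2 sm) auto
    also have "(\<Sum>k. 2 * N * \<delta> * ?b k) = 2 * N * \<delta> * B"
      unfolding B_def by (intro suminf_mult summable_inverse_mult_ln_squared)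
    finally have em: "emeasure lborel (\<Union>k. E k) \<le> ennreal (2 * N * \<delta> * B)" .
    have "2 * N * \<delta> * B \<le> 2 * N * (e / (4 * N * (B + 1))) * B"
      using N B by (intro mult_right_mono mult_left_mono) (auto simp: \<delta>_def)
    also have "\<dots> = e / 2 * (B / (B + 1))" using N B by (simp add: divide_simps)
    also have "\<dots> \<le> e / 2 * 1" using \<open>e > 0\<close> B by (intro mult_left_mono) (auto simp: divide_simps)
    also have "\<dots> < e" using \<open>e > 0\<close> by simp
    finally have small: "2 * N * \<delta> * B < e" .
    have bor: "(\<Union>k. E k) \<in> sets lborel" using Em by auto
    have fin: "emeasure lborel (\<Union>k. E k) < \<infinity>"
      using em by (rule le_less_trans) simp
    have eq: "emeasure lebesgue (\<Union>k. E k) = emeasure lborel (\<Union>k. E k)" using bor by simp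
    have "(\<Union>k. E k) \<in> lmeasurable" using bor fin eq by (intro fmeasurableI) auto
    moreover have "measure lebesgue (\<Union>k. E k) < e"
    proof -
      have "measure lebesgue (\<Union>k. E k) \<le> 2 * N * \<delta> * B"
        unfolding measure_def eq using em N \<delta> B by (intro enn2real_leI) auto
      with small show ?thesis by simp
    qed
    ultimately show "\<exists>T. {\<alpha>. \<not> typical \<alpha>} \<inter> {- real n..real n} \<subseteq> T \<and> T \<in> lmeasurable \<and> measure lebesgue T < e"
      using sub by blast
  qed
  then have "negligible (\<Union>n. {\<alpha>. \<not> typical \<alpha>} \<inter> {- real n..real n})"
    by (rule negligible_Union_nat)
  moreover have "(\<Union>n. {\<alpha>. \<not> typical \<alpha>} \<inter> {- real n..real n}) = {\<alpha>. \<not> typical \<alpha>}"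
  proof safe
    fix \<alpha> assume "\<not> typical \<alpha>"
    moreover obtain n where "\<bar>\<alpha>\<bar> \<le> real n" using real_arch_simple by blast
    ultimately show "\<alpha> \<in> (\<Union>n. {\<alpha>. \<not> typical \<alpha>} \<inter> {- real n..real n})"
      by (intro UN_I[of n]) (auto simp: abs_le_iff)
  qed
  ultimately show ?thesis by simp
qed

subsection \<open>Finitely differentiable functions\<close>

text \<open>\<open>n\<close> times continuously differentiable at every point of \<open>S\<close>, with two-sided
  derivatives; the notion is only meant for open \<open>S\<close>.\<close>

primrec Cdiff :: "nat \<Rightarrow> (real \<Rightarrow> real) \<Rightarrow> real set \<Rightarrow> bool" where
  "Cdiff 0 f S = continuous_on S f"
| "Cdiff (Suc n) f S =
     (\<exists>f'. (\<forall>x\<in>S. (f has_real_derivative f' x) (at x)) \<and> Cdiff n f' S)"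

declare Cdiff.simps(2) [simp del]

lemma Cdiff_SucI:
  "(\<And>x. x \<in> S \<Longrightarrow> (f has_real_derivative f' x) (at x)) \<Longrightarrow> Cdiff n f' S \<Longrightarrow> Cdiff (Suc n) f S"
  unfolding Cdiff.simps by blast

lemma Cdiff_SucE:
  assumes "Cdiff (Suc n) f S"
  obtains f' where "\<And>x. x \<in> S \<Longrightarrow> (f has_real_derivative f' x) (at x)" "Cdiff n f' S"
  using assms unfolding Cdiff.simps by blast

lemma DERIV_imp_continuous_on:
  "(\<And>x. x \<in> S \<Longrightarrow> (f has_real_derivative f' x) (at x)) \<Longrightarrow> continuous_on S f"
  by (meson DERIV_isCont continuous_at_imp_continuous_on)

lemma Cdiff_imp_continuous_on: "Cdiff n f S \<Longrightarrow> continuous_on S f"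
proof (cases n)
  case (Suc m)
  assume "Cdiff n f S"
  then show ?thesis unfolding Suc by (rule Cdiff_SucE) (rule DERIV_imp_continuous_on)
qed simp

lemma Cdiff_Suc_D: "Cdiff (Suc n) f S \<Longrightarrow> Cdiff n f S"
proof (induction n arbitrary: f)
  case 0 then show ?case using Cdiff_imp_continuous_on by auto
next
  case (Suc n)
  obtain f' where f': "\<And>x. x \<in> S \<Longrightarrow> (f has_real_derivative f' x) (at x)" "Cdiff (Suc n) f' S"
    by (rule Cdiff_SucE[OF Suc.prems]) blast
  show ?case by (rule Cdiff_SucI[OF f'(1) Suc.IH[OF f'(2)]])
qed

lemma Cdiff_subset: "Cdiff n f S \<Longrightarrow> T \<subseteq> S \<Longrightarrow> Cdiff n f T"
proof (induction n arbitrary: f)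
  case 0 then show ?case by (auto intro: continuous_on_subset)
next
  case (Suc n)
  obtain f' where f': "\<And>x. x \<in> S \<Longrightarrow> (f has_real_derivative f' x) (at x)" "Cdiff n f' S"
    by (rule Cdiff_SucE[OF Suc.prems(1)]) blast
  show ?case
    using Suc.prems(2) by (intro Cdiff_SucI[OF f'(1) Suc.IH[OF f'(2)]]) auto
qed

lemma Cdiff_const: "Cdiff n (\<lambda>x. c) S"
proof (induction n arbitrary: c)
  case (Suc n)
  show ?case by (rule Cdiff_SucI[OF DERIV_const Suc.IH])
qed simp

lemma Cdiff_ident: "Cdiff n (\<lambda>x. x) S"
proof (cases n)
  case (Suc m)
  then show ?thesis using Cdiff_SucI[OF DERIV_ident Cdiff_const] by simp
qed simp

lemma Cdiff_add: "Cdiff n f S \<Longrightarrow> Cdiff n g S \<Longrightarrow> Cdiff n (\<lambda>x. f x + g x) S"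
proof (induction n arbitrary: f g)
  case 0 then show ?case by (auto intro: continuous_intros)
next
  case (Suc n)
  obtain f' g' where "\<And>x. x \<in> S \<Longrightarrow> (f has_real_derivative f' x) (at x)" "Cdiff n f' S"
    "\<And>x. x \<in> S \<Longrightarrow> (g has_real_derivative g' x) (at x)" "Cdiff n g' S"
    using Suc.prems by (elim Cdiff_SucE) blast
  then show ?case using Suc.IH[of f' g'] by (intro Cdiff_SucI[of S _ "\<lambda>x. f' x + g' x"] DERIV_add) auto
qed

lemma Cdiff_mult: "Cdiff n f S \<Longrightarrow> Cdiff n g S \<Longrightarrow> Cdiff n (\<lambda>x. f x * g x) S"
proof (induction n arbitrary: f g)
  case 0 then show ?case by (auto intro: continuous_intros)
next
  case (Suc n)
  obtain f' g' where "\<And>x. x \<in> S \<Longrightarrow> (f has_real_derivative f' x) (at x)" "Cdiff n f' S"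
    "\<And>x. x \<in> S \<Longrightarrow> (g has_real_derivative g' x) (at x)" "Cdiff n g' S"
    using Suc.prems by (elim Cdiff_SucE) blast
  moreover have "Cdiff n f S" "Cdiff n g S" using Suc.prems by (auto intro: Cdiff_Suc_D)
  ultimately show ?case
    by (intro Cdiff_SucI[of S _ "\<lambda>x. f' x * g x + g' x * f x"] Cdiff_add Suc.IH DERIV_mult) auto
qed

lemma Cdiff_compose:
  "Cdiff n f T \<Longrightarrow> Cdiff n g S \<Longrightarrow> g ` S \<subseteq> T \<Longrightarrow> Cdiff n (\<lambda>x. f (g x)) S"
proof (induction n arbitrary: f)
  case 0 then show ?case using continuous_on_compose2[of T f S g] by simp
next
  case (Suc n)
  obtain f' g' where d: "\<And>x. x \<in> T \<Longrightarrow> (f has_real_derivative f' x) (at x)" "Cdiff n f' T"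
    "\<And>x. x \<in> S \<Longrightarrow> (g has_real_derivative g' x) (at x)" "Cdiff n g' S"
    using Suc.prems(1,2) by (elim Cdiff_SucE) blast
  have "Cdiff n g S" using Suc.prems(2) by (rule Cdiff_Suc_D)
  then have "Cdiff n (\<lambda>x. f' (g x) * g' x) S"
    using d Suc.IH[of f'] Suc.prems(3) by (intro Cdiff_mult) auto
  moreover have "((\<lambda>x. f (g x)) has_real_derivative f' (g x) * g' x) (at x)" if "x \<in> S" for x
    by (rule DERIV_chain2[OF d(1) d(3)]) (use that Suc.prems(3) in auto)
  ultimately show ?case by (rule Cdiff_SucI[rotated])
qed

lemma Cdiff_inverse: "Cdiff n (inverse :: real \<Rightarrow> real) (- {0})"
proof (induction n)
  case 0 then show ?case by (auto intro: continuous_intros)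
next
  case (Suc n)
  have "Cdiff n (\<lambda>x. - 1 * (inverse x * inverse x)) (- {0::real})"
    by (intro Cdiff_mult Cdiff_const Suc)
  moreover have "(inverse has_real_derivative - 1 * (inverse x * inverse x)) (at x)"
    if "x \<in> - {0}" for x :: real
    using DERIV_inverse[of x] that by (simp add: numeral_2_eq_2 power2_eq_square)
  ultimately show ?case by (rule Cdiff_SucI[rotated])
qed

lemma Cdiff_sqrt: "Cdiff n sqrt {0<..}"
proof (induction n)
  case 0 then show ?case by (auto intro: continuous_intros)
next
  case (Suc n)
  have "Cdiff n (\<lambda>x. inverse (sqrt x)) {0<..}"
    by (rule Cdiff_compose[OF Cdiff_inverse Suc]) auto
  then have "Cdiff n (\<lambda>x. inverse (sqrt x) * (1 / 2)) {0<..}"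
    by (intro Cdiff_mult Cdiff_const)
  moreover have "(sqrt has_real_derivative inverse (sqrt x) * (1 / 2)) (at x)"
    if "x \<in> {0<..}" for x
    using DERIV_real_sqrt[of x] that by simp
  ultimately show ?case by (rule Cdiff_SucI[rotated])
qed

text \<open>Bootstrap on \<open>\<phi>' = 1 / y' (\<phi> s)\<close>: the regularity already known
  for \<open>\<phi>\<close>, up to that of \<open>y'\<close>, passes to \<open>\<phi>'\<close>, so
  each step gains one order.\<close>

lemma Cdiff_local_inverse:
  assumes "Cdiff n y' J" "\<phi> ` S \<subseteq> J" "\<And>x. x \<in> J \<Longrightarrow> y' x \<noteq> 0"
    and d: "\<And>s. s \<in> S \<Longrightarrow> (\<phi> has_real_derivative inverse (y' (\<phi> s))) (at s)"
  shows "Cdiff (Suc n) \<phi> S"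
  using assms(1)
proof (induction n)
  case 0
  have "continuous_on S \<phi>" using d by (rule DERIV_imp_continuous_on)
  then have "continuous_on S (\<lambda>s. y' (\<phi> s))"
    using 0 assms(2) by (intro continuous_on_compose2[of J y' S \<phi>]) auto
  then have "continuous_on S (\<lambda>s. inverse (y' (\<phi> s)))"
    using assms(2,3) by (intro continuous_on_inverse) auto
  then show ?case unfolding Cdiff.simps(1)[symmetric] by (rule Cdiff_SucI[rotated]) (rule d)
next
  case (Suc n)
  have "Cdiff (Suc n) \<phi> S" by (rule Suc.IH[OF Cdiff_Suc_D[OF Suc.prems]])
  then have "Cdiff (Suc n) (\<lambda>s. y' (\<phi> s)) S"
    using Suc.prems assms(2) by (intro Cdiff_compose[of "Suc n" y' J \<phi> S])
  then have "Cdiff (Suc n) (\<lambda>s. inverse (y' (\<phi> s))) S"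
    using assms(2,3) by (intro Cdiff_compose[OF Cdiff_inverse]) auto
  then show ?case by (rule Cdiff_SucI[rotated]) (rule d)
qed

lemma Cdiff_cong:
  "open S \<Longrightarrow> Cdiff n f S \<Longrightarrow> (\<And>x. x \<in> S \<Longrightarrow> f x = g x) \<Longrightarrow> Cdiff n g S"
proof (cases n)
  case 0
  assume "Cdiff n f S" "\<And>x. x \<in> S \<Longrightarrow> f x = g x"
  then show ?thesis unfolding 0 Cdiff.simps by (metis continuous_on_cong)
next
  case (Suc k)
  assume S: "open S" and f: "Cdiff n f S" and eq: "\<And>x. x \<in> S \<Longrightarrow> f x = g x"
  obtain f' where f': "\<And>x. x \<in> S \<Longrightarrow> (f has_real_derivative f' x) (at x)" "Cdiff k f' S"
    by (rule Cdiff_SucE[OF f[unfolded Suc]]) blast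
  have "(g has_real_derivative f' x) (at x)" if "x \<in> S" for x
    by (rule has_field_derivative_transform_within_open[OF f'(1)[OF that] S that]) (rule eq)
  then show ?thesis unfolding Suc using f'(2) by (rule Cdiff_SucI)
qed

lemma Cdiff_deriv:
  assumes "open S" "\<And>n. Cdiff n f S"
  shows "Cdiff n (deriv f) S" and "x \<in> S \<Longrightarrow> (f has_real_derivative deriv f x) (at x)"
proof -
  obtain f' where f': "\<And>x. x \<in> S \<Longrightarrow> (f has_real_derivative f' x) (at x)" "Cdiff n f' S"
    by (rule Cdiff_SucE[OF assms(2)[of "Suc n"]]) blast
  show "Cdiff n (deriv f) S"
    by (rule Cdiff_cong[OF assms(1) f'(2)]) (metis f'(1) DERIV_imp_deriv)
  show "x \<in> S \<Longrightarrow> (f has_real_derivative deriv f x) (at x)"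
    using f'(1) DERIV_imp_deriv by metis
qed

section \<open>Integrals depending on a scaled variable\<close>

lemma continuous_on_scaled_kernel:
  fixes w s f :: "real \<Rightarrow> real"
  assumes w: "continuous_on {a..b} w" and s: "continuous_on {a..b} s" and f: "continuous_on S f"
    and inv: "\<And>x t. x \<in> S \<Longrightarrow> t \<in> {a..b} \<Longrightarrow> s t * x \<in> S"
  shows "continuous_on (S \<times> cbox a b) (\<lambda>(x, t). w t * f (s t * x))"
proof -
  have snd: "continuous_on (S \<times> cbox a b) snd" and fst: "continuous_on (S \<times> cbox a b) fst"
    by (simp_all add: continuous_on_fst continuous_on_snd continuous_on_id)
  have cw: "continuous_on (S \<times> cbox a b) (\<lambda>p. w (snd p))"
    by (rule continuous_on_compose2[OF w snd]) auto
  have cs: "continuous_on (S \<times> cbox a b) (\<lambda>p. s (snd p))"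
    by (rule continuous_on_compose2[OF s snd]) auto
  have "(\<lambda>p. s (snd p) * fst p) ` (S \<times> cbox a b) \<subseteq> S"
    using inv by (auto simp: image_subset_iff)
  from continuous_on_mult[OF cw continuous_on_compose2[OF f continuous_on_mult[OF cs fst] this]]
  show ?thesis unfolding split_beta .
qed

lemma continuous_on_integral_scaled:
  fixes w s f :: "real \<Rightarrow> real"
  assumes "continuous_on {a..b} w" "continuous_on {a..b} s" "continuous_on S f"
    and "\<And>x t. x \<in> S \<Longrightarrow> t \<in> {a..b} \<Longrightarrow> s t * x \<in> S"
  shows "continuous_on S (\<lambda>x. integral {a..b} (\<lambda>t. w t * f (s t * x)))"
  using integral_continuous_on_param[OF continuous_on_scaled_kernel[OF assms]] by simp

lemma has_real_derivative_integral_scaled: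
  fixes w s f :: "real \<Rightarrow> real"
  assumes "continuous_on {a..b} w" "continuous_on {a..b} s" "continuous_on S f'"
    and "open S" "convex S" "x \<in> S"
    and inv: "\<And>x t. x \<in> S \<Longrightarrow> t \<in> {a..b} \<Longrightarrow> s t * x \<in> S"
    and d: "\<And>x. x \<in> S \<Longrightarrow> (f has_real_derivative f' x) (at x)"
  shows "((\<lambda>x. integral {a..b} (\<lambda>t. w t * f (s t * x))) has_real_derivative
           integral {a..b} (\<lambda>t. w t * s t * f' (s t * x))) (at x)"
proof -
  have cf: "continuous_on S f"
    using d by (rule DERIV_imp_continuous_on)
  have "((\<lambda>x. integral (cbox a b) (\<lambda>t. w t * f (s t * x))) has_field_derivative
           integral (cbox a b) (\<lambda>t. w t * s t * f' (s t * x))) (at x within S)"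
  proof (rule leibniz_rule_field_derivative)
    fix z t assume zt: "z \<in> S" "t \<in> cbox a b"
    have "s t * z \<in> S" using zt by (intro inv) simp_all
    from d[OF this] have "(f has_real_derivative f' (s t * z)) (at (s t * z))" .
    moreover have "((\<lambda>x. s t * x) has_real_derivative s t) (at z)"
      using DERIV_cmult[OF DERIV_ident, of "s t" z] by simp
    ultimately have "((\<lambda>x. f (s t * x)) has_real_derivative f' (s t * z) * s t) (at z)"
      by (rule DERIV_chain2)
    from has_field_derivative_at_within[OF DERIV_cmult[OF this, of "w t"], of S]
    show "((\<lambda>x. w t * f (s t * x)) has_field_derivative w t * s t * f' (s t * z)) (at z within S)"
      by (simp only: mult_ac)
  next
    fix z assume "z \<in> S"
    then have "(\<lambda>t. s t * z) ` {a..b} \<subseteq> S" by (intro image_subsetI inv)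
    then have "continuous_on {a..b} (\<lambda>t. w t * f (s t * z))"
      by (rule continuous_on_mult[OF assms(1) continuous_on_compose2[OF cf
            continuous_on_mult_right[OF assms(2)]]])
    then show "(\<lambda>t. w t * f (s t * z)) integrable_on cbox a b"
      by (simp only: box_real integrable_continuous_real)
  next
    show "continuous_on (S \<times> cbox a b) (\<lambda>(x, t). w t * s t * f' (s t * x))"
      by (rule continuous_on_scaled_kernel[OF continuous_on_mult[OF assms(1,2)] assms(2,3) inv])
  qed (rule \<open>x \<in> S\<close> \<open>convex S\<close>)+
  then show ?thesis by (simp only: at_within_open[OF assms(6,4)] box_real)
qed

text \<open>The form \<open>w t * f (s t * x)\<close> is stable under differentiation in
  \<open>x\<close>, which turns the weight into \<open>w t * s t\<close>; hence the induction runs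
  over all weights. It serves both Taylor's remainder (\<open>s t = t\<close>) and the integrals
  over arcs (\<open>s = sin\<close>).\<close>

lemma Cdiff_integral_scaled:
  fixes w s f :: "real \<Rightarrow> real"
  assumes "Cdiff n f S" "continuous_on {a..b} w" and s: "continuous_on {a..b} s"
    and S: "open S" "convex S"
    and inv: "\<And>x t. x \<in> S \<Longrightarrow> t \<in> {a..b} \<Longrightarrow> s t * x \<in> S"
  shows "Cdiff n (\<lambda>x. integral {a..b} (\<lambda>t. w t * f (s t * x))) S"
  using assms(1,2)
proof (induction n arbitrary: f w)
  case 0
  have "continuous_on S (\<lambda>x. integral {a..b} (\<lambda>t. w t * f (s t * x)))"
    by (rule continuous_on_integral_scaled[OF 0(2) s Cdiff_imp_continuous_on[OF 0(1)] inv])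
  then show ?case unfolding Cdiff.simps(1) .
next
  case (Suc n)
  obtain f' where f': "\<And>x. x \<in> S \<Longrightarrow> (f has_real_derivative f' x) (at x)" "Cdiff n f' S"
    using Suc.prems(1) by (elim Cdiff_SucE) blast
  have "Cdiff n (\<lambda>x. integral {a..b} (\<lambda>t. w t * s t * f' (s t * x))) S"
    by (rule Suc.IH[OF f'(2) continuous_on_mult[OF Suc.prems(2) s]])
  moreover have "((\<lambda>x. integral {a..b} (\<lambda>t. w t * f (s t * x))) has_real_derivative
      integral {a..b} (\<lambda>t. w t * s t * f' (s t * x))) (at x)" if "x \<in> S" for x
    by (rule has_real_derivative_integral_scaled[OF Suc.prems(2) s
         Cdiff_imp_continuous_on[OF f'(2)] S that inv f'(1)])
  ultimately show ?case by (rule Cdiff_SucI[rotated])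
qed

subsection \<open>Sard's theorem in dimension one\<close>

text \<open>\<open>baby_Sard\<close> treats maps of Cartesian spaces whose derivative has deficient
  rank; in dimension one this is the zero derivative, of rank 0. The maps \<open>vec\<close> and
  \<open>$ 1\<close> carry the problem to \<open>real^1\<close> and back.\<close>

lemma negligible_critical_values:
  fixes h :: "real \<Rightarrow> real"
  assumes "\<And>x. x \<in> S \<Longrightarrow> (h has_real_derivative 0) (at x)"
  shows "negligible (h ` S)"
proof -
  define S1 where "S1 = {v :: real^1. v $ 1 \<in> S}"
  define F where "F v = (vec (h (v $ 1)) :: real^1)" for v :: "real^1"
  have "(F has_derivative (\<lambda>w. 0)) (at v within S1)" if "v \<in> S1" for v
  proof -
    have "(h has_derivative (\<lambda>t. 0)) (at (v $ 1))"
      using assms[of "v $ 1"] that by (simp add: S1_def has_field_derivative_def lambda_zero)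
    from has_derivative_compose[OF bounded_linear.has_derivative[OF bounded_linear_vec_nth has_derivative_ident] this]
    have "((\<lambda>v. h (v $ 1)) has_derivative (\<lambda>w. 0)) (at v within S1)" by simp
    from bounded_linear.has_derivative[OF _ this, of vec]
    show ?thesis unfolding F_def by (simp add: linear_conv_bounded_linear[symmetric])
  qed
  moreover have "rank (matrix (\<lambda>w :: real^1. 0 :: real^1)) < CARD(1)"
  proof -
    have "matrix (\<lambda>w :: real^1. 0 :: real^1) = 0" by (simp add: matrix_def vec_eq_iff)
    then show ?thesis by simp
  qed
  ultimately have "negligible (F ` S1)" by (intro baby_Sard) auto
  then have "negligible ((\<lambda>v :: real^1. v $ 1) ` F ` S1)"
    by (rule negligible_differentiable_image_negligible[rotated])
       (auto intro!: linear_imp_differentiable_on bounded_linear.linear[OF bounded_linear_vec_nth])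
  moreover have "(\<lambda>v :: real^1. v $ 1) ` F ` S1 = h ` S"
  proof -
    have "h x \<in> (\<lambda>v :: real^1. v $ 1) ` F ` S1" if "x \<in> S" for x
      using that by (auto simp: F_def S1_def image_image intro!: image_eqI[of _ _ "vec x"])
    then show ?thesis by (auto simp: F_def S1_def)
  qed
  ultimately show ?thesis by simp
qed

text \<open>Used with \<open>T\<close> the set of numbers that are not typical: a slope that moves
  with nonzero speed is typical for almost every parameter.\<close>

lemma negligible_nondegenerate_vimage:
  fixes s :: "real \<Rightarrow> real"
  assumes "negligible T" "\<And>x. x \<in> S \<Longrightarrow> (s has_real_derivative s' x) (at x)"
    and "\<And>x. x \<in> S \<Longrightarrow> s' x \<noteq> 0"
  shows "negligible {x \<in> S. s x \<in> T}"
proof (rule negligible_differentiable_vimage[OF assms(1)])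
  show "inj ((*) (s' x))" if "x \<in> S" for x using assms(3)[OF that] by (auto intro: injI)
  show "(s has_derivative (*) (s' x)) (at x within S)" if "x \<in> S" for x
    using assms(2)[OF that] by (auto simp: has_field_derivative_def intro: has_derivative_at_withinI)
qed

text \<open>Shifting by \<open>b\<close> turns the zeros of the curvature into the solutions of \<open>h x = b\<close>, where
  \<open>h = - f1 / (2 f2) - x\<close>, and their order and slope into a regularity condition on \<open>h\<close>.\<close>

lemma negligible_degenerate_shifts:
  fixes f1 f2 f3 :: "real \<Rightarrow> real"
  assumes d1: "\<And>x. x \<in> I \<Longrightarrow> (f1 has_real_derivative f2 x) (at x)"
    and d2: "\<And>x. x \<in> I \<Longrightarrow> (f2 has_real_derivative f3 x) (at x)"
    and neg: "\<And>x. x \<in> I \<Longrightarrow> f1 x < 0"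
  shows "negligible {b. \<exists>x\<in>I. x + b > 0 \<and> f1 x + 2 * (x + b) * f2 x = 0 \<and>
     (3 * f2 x + 2 * (x + b) * f3 x = 0 \<or> \<not> typical (1 / (2 * sqrt (x + b) * f1 x)))}"
proof -
  define X where "X = {x \<in> I. f2 x \<noteq> 0}"
  define h where "h x = - f1 x / (2 * f2 x) - x" for x
  define h' where "h' x = f1 x * f3 x / (2 * (f2 x)\<^sup>2) - 3 / 2" for x
  define s where "s x = 1 / (2 * (sqrt (x + h x) * f1 x))" for x
  define Y where "Y = {x \<in> X. h' x \<noteq> 0 \<and> x + h x > 0}"
  have dh: "(h has_real_derivative h' x) (at x)" if "x \<in> X" for x
    using that d1[of x] d2[of x] unfolding h_def h'_def X_def
    by (auto intro!: derivative_eq_intros simp: power2_eq_square field_simps)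
  have "negligible (h ` {x \<in> X. h' x = 0})"
    using dh by (intro negligible_critical_values) (metis (mono_tags, lifting) mem_Collect_eq)
  moreover have "negligible (h ` {x \<in> Y. s x \<in> {\<alpha>. \<not> typical \<alpha>}})"
  proof (rule negligible_differentiable_image_negligible[OF order_refl])
    define s' where "s' x = - (h' x * f1 x / (2 * sqrt (x + h x))) / (2 * (sqrt (x + h x) * f1 x)\<^sup>2)" for x
    show "negligible {x \<in> Y. s x \<in> {\<alpha>. \<not> typical \<alpha>}}"
    proof (rule negligible_nondegenerate_vimage[OF negligible_not_typical])
      fix x assume "x \<in> Y"
      then have x: "x \<in> X" "x \<in> I" "f2 x \<noteq> 0" "h' x \<noteq> 0" "x + h x > 0" by (auto simp: Y_def X_def)
      define z where "z = sqrt (x + h x)"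
      have z: "z > 0" "z * z = x + h x" using x(5) by (auto simp: z_def)
      \<comment> \<open>The equation of a curvature zero at \<open>b = h x\<close>, with
        \<open>z * z = x + b\<close>.\<close>
      have z2: "2 * z * z * f2 x = - f1 x" unfolding mult.assoc[of 2 z z] z(2) using x(3) by (simp add: h_def)
      have f1: "f1 x < 0" by (rule neg[OF x(2)])
      show "s' x \<noteq> 0" unfolding s'_def using f1 x(4) z(1) unfolding z_def by auto
      have "((\<lambda>x. sqrt (x + h x)) has_real_derivative (1 + h' x) * inverse z / 2) (at x)"
        using dh[OF x(1)] x(5) unfolding z_def by (auto intro!: derivative_eq_intros)
      from DERIV_mult[OF this d1[OF x(2)]]
      have "((\<lambda>x. sqrt (x + h x) * f1 x) has_real_derivative (1 + h' x) * inverse z / 2 * f1 x + f2 x * z) (at x)"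
        by (simp add: z_def)
      \<comment> \<open>The cancellation: by \<open>z2\<close> the terms without \<open>h'\<close>
        sum to zero.\<close>
      moreover have "(1 + h' x) * inverse z / 2 * f1 x + f2 x * z = h' x * f1 x / (2 * z)"
        using z(1) z2 by (simp add: field_simps)
      ultimately have Q: "((\<lambda>x. sqrt (x + h x) * f1 x) has_real_derivative h' x * f1 x / (2 * z)) (at x)"
        by simp
      have "((\<lambda>x. inverse (2 * (sqrt (x + h x) * f1 x))) has_real_derivative s' x) (at x)"
        by (rule DERIV_cong[OF DERIV_inverse'[OF DERIV_cmult[OF Q, of 2]]])
           (use f1 z in \<open>simp_all add: s'_def z_def[symmetric] power2_eq_square divide_simps\<close>)
      then show "(s has_real_derivative s' x) (at x)"
        unfolding s_def by (simp add: inverse_eq_divide)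
    qed
    show "h differentiable_on {x \<in> Y. s x \<in> {\<alpha>. \<not> typical \<alpha>}}"
      unfolding differentiable_on_def real_differentiable_def using dh
      by (auto simp: Y_def intro: has_field_derivative_at_within)
  qed
  ultimately have "negligible (h ` {x \<in> X. h' x = 0} \<union> h ` {x \<in> Y. s x \<in> {\<alpha>. \<not> typical \<alpha>}})"
    by (rule negligible_Un)
  moreover have "{b. \<exists>x\<in>I. x + b > 0 \<and> f1 x + 2 * (x + b) * f2 x = 0 \<and>
     (3 * f2 x + 2 * (x + b) * f3 x = 0 \<or> \<not> typical (1 / (2 * sqrt (x + b) * f1 x)))}
     \<subseteq> h ` {x \<in> X. h' x = 0} \<union> h ` {x \<in> Y. s x \<in> {\<alpha>. \<not> typical \<alpha>}}"
  proof
    fix b assume "b \<in> {b. \<exists>x\<in>I. x + b > 0 \<and> f1 x + 2 * (x + b) * f2 x = 0 \<and>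
     (3 * f2 x + 2 * (x + b) * f3 x = 0 \<or> \<not> typical (1 / (2 * sqrt (x + b) * f1 x)))}"
    then obtain x where *: "x \<in> I" "x + b > 0" "f1 x + 2 * (x + b) * f2 x = 0"
      "3 * f2 x + 2 * (x + b) * f3 x = 0 \<or> \<not> typical (1 / (2 * sqrt (x + b) * f1 x))"
      by blast
    have f2: "f2 x \<noteq> 0" using *(3) neg[OF *(1)] by auto
    have hb: "h x = b" using *(3) f2 by (simp add: h_def field_simps)
    have X: "x \<in> X" using *(1) f2 by (simp add: X_def)
    show "b \<in> h ` {x \<in> X. h' x = 0} \<union> h ` {x \<in> Y. s x \<in> {\<alpha>. \<not> typical \<alpha>}}"
    proof (cases "h' x = 0")
      case True
      then show ?thesis using X hb by auto
    next
      case False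
      then have Y: "x \<in> Y" using X *(2) hb by (simp add: Y_def)
      \<comment> \<open>The left side is \<open>2 * (f2 x)^2 * h' x\<close>, and the first term on
        the right vanishes at a curvature zero. So regular points of \<open>h\<close> correspond to
        simple zeros.\<close>
      have "f1 x * f3 x - 3 * (f2 x)\<^sup>2 =
          f3 x * (f1 x + 2 * (x + b) * f2 x) - f2 x * (3 * f2 x + 2 * (x + b) * f3 x)"
        by (simp add: algebra_simps power2_eq_square)
      then have "3 * f2 x + 2 * (x + b) * f3 x \<noteq> 0"
        using False *(3) f2 by (auto simp: h'_def)
      then have "\<not> typical (s x)" using *(4) by (simp add: s_def hb mult.assoc)
      then show ?thesis using Y hb by auto
    qed
  qed
  ultimately show ?thesis by (rule negligible_subset)
qed

subsection \<open>Shifting a potential by a constant\<close>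

lemma funpow_deriv_add_const:
  assumes "U differentiable_on UNIV"
  shows "(deriv ^^ Suc k) (\<lambda>q. U q + b) = (deriv ^^ Suc k) (U :: real \<Rightarrow> real)"
proof -
  have "deriv (\<lambda>q. U q + b) = deriv U"
  proof
    fix q
    have "U field_differentiable at q"
      using assms by (auto simp: differentiable_on_def field_differentiable_def real_differentiable_def)
    then show "deriv (\<lambda>q. U q + b) q = deriv U q" by (simp add: deriv_add)
  qed
  then show ?thesis by (simp only: funpow_Suc_right o_apply)
qed

lemma smooth_periodic_add_const:
  assumes "U \<in> smooth_periodic" shows "(\<lambda>q. U q + b) \<in> smooth_periodic"
proof -
  have "(deriv ^^ 0) U differentiable_on UNIV" using assms unfolding smooth_periodic_def by blast
  then have d: "U differentiable_on UNIV" by simp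
  have "(deriv ^^ k) (\<lambda>q. U q + b) differentiable_on UNIV" for k
  proof (cases k)
    case 0 then show ?thesis using d by (auto intro: derivative_intros)
  next
    case (Suc j)
    then show ?thesis using assms unfolding smooth_periodic_def funpow_deriv_add_const[OF d] Suc by blast
  qed
  then show ?thesis using assms by (simp add: smooth_periodic_def)
qed

lemma smooth_periodic_differentiable: "U \<in> smooth_periodic \<Longrightarrow> U differentiable_on UNIV"
  unfolding smooth_periodic_def using funpow_0 by (metis (no_types, lifting) mem_Collect_eq)

lemma Omega_rev_add_const:
  assumes "U \<in> Omega_rev" "b > 0" shows "(\<lambda>q. U q + b) \<in> Omega_rev"
proof -
  have "U \<in> smooth_periodic" using assms(1) by (simp add: Omega_rev_def)
  note d = smooth_periodic_differentiable[OF this] smooth_periodic_add_const[OF this, of b]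
  have "deriv (\<lambda>q. U q + b) = deriv U" using funpow_deriv_add_const[OF d(1), of 0 b] by simp
  moreover have "local_min (\<lambda>q. U q + b) = local_min U" "local_max (\<lambda>q. U q + b) = local_max U"
    by (auto simp: local_min_def local_max_def fun_eq_iff)
  moreover have "U q + b > 0" for q using assms unfolding Omega_rev_def by (auto intro: add_pos_pos)
  ultimately show ?thesis using assms(1) d(2) unfolding Omega_rev_def by simp
qed

lemma Cn_near_add_const:
  assumes "U \<in> smooth_periodic" "0 < b" "b < e" shows "Cn_near n e U (\<lambda>q. U q + b)"
  unfolding Cn_near_def
proof (intro allI impI)
  fix k q
  show "\<bar>(deriv ^^ k) (\<lambda>q. U q + b) q - (deriv ^^ k) U q\<bar> < e"
    using assms(2,3) by (cases k) (simp_all only: funpow_deriv_add_const[OF smooth_periodic_differentiable[OF assms(1)]], auto)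
qed

lemma F1_add_const: "F1 (\<lambda>q. U q + b) c = F1 U (c - b)"
proof -
  have "{q \<in> {0..1}. c \<le> U q + b} = {q \<in> {0..1}. c - b \<le> U q}" by auto
  then show ?thesis unfolding F1_def by (simp add: algebra_simps)
qed

section \<open>Derivatives relative to the curve domain\<close>

lemma curve_domain_nonisolated:
  assumes "c_min U < c_max U" "c \<in> curve_domain U" shows "at c within curve_domain U \<noteq> bot"
proof -
  have "c islimpt curve_domain U"
  proof (cases "c < c_min U")
    case True
    then have "c islimpt {c<..<c_min U}" by (rule islimpt_greaterThanLessThan1)
    then show ?thesis by (rule islimpt_subset) (use assms(2) True in \<open>auto simp: curve_domain_def\<close>)
  next
    case False
    then have "c_min U < c" using assms(2) by (auto simp: curve_domain_def)
    then have "c islimpt {c_min U<..<c}" by (rule islimpt_greaterThanLessThan2)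
    then show ?thesis by (rule islimpt_subset) (use assms(2) False in \<open>auto simp: curve_domain_def\<close>)
  qed
  then show ?thesis by (simp add: trivial_limit_within)
qed

text \<open>A derivative within a set is unique at limit points of the set; as
  \<open>curve_domain U\<close> has no isolated points, \<open>dc\<close> is determined even at its
  end points.\<close>

lemma dc_eqI:
  assumes "c_min U < c_max U" "c \<in> curve_domain U"
    and "(f has_real_derivative D) (at c within curve_domain U)"
  shows "dc U f c = D"
  unfolding dc_def using assms
  by (intro vector_derivative_within curve_domain_nonisolated)
     (simp_all add: has_real_derivative_iff_has_vector_derivative)

lemma at_within_curve_domain_upper:
  assumes "c \<in> {c_min U<..c_max U}"
  shows "at c within curve_domain U = at c within {c_min U<..c_max U}"
  by (rule at_within_nhd[of _ "{c_min U<..}"]) (use assms in \<open>auto simp: curve_domain_def\<close>)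

lemma dc_F2:
  assumes "c_min U < c_max U" "c \<in> curve_domain U" "c > 0"
  shows "dc U F2 c = 1 / (2 * sqrt c)"
proof (rule dc_eqI[OF assms(1,2)])
  have "(F2 has_real_derivative 1 / (2 * sqrt c)) (at c)"
    using DERIV_real_sqrt[OF assms(3)] unfolding F2_def[abs_def] by (simp add: field_simps)
  then show "(F2 has_real_derivative 1 / (2 * sqrt c)) (at c within curve_domain U)"
    by (rule has_field_derivative_at_within)
qed

lemma dc_dc_F2:
  assumes "c_min U < c_max U" "c \<in> curve_domain U" "c > 0"
  shows "dc U (dc U F2) c = - 1 / (4 * (c * sqrt c))"
proof (rule dc_eqI[OF assms(1,2)])
  have "((\<lambda>c. 1 / (2 * sqrt c)) has_real_derivative - 1 / (4 * (c * sqrt c))) (at c)"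
    using assms(3) by (auto intro!: derivative_eq_intros simp: field_simps power2_eq_square)
  then have "((\<lambda>c. 1 / (2 * sqrt c)) has_real_derivative - 1 / (4 * (c * sqrt c))) (at c within curve_domain U)"
    by (rule has_field_derivative_at_within)
  then show "(dc U F2 has_real_derivative - 1 / (4 * (c * sqrt c))) (at c within curve_domain U)"
    \<comment> \<open>The radius of the neighbourhood is \<open>c\<close> itself, so all its points
      stay positive and the formula for the first derivative applies.\<close>
    by (rule has_field_derivative_transform_within[OF _ assms(3,2)])
       (auto simp: dc_F2[OF assms(1)] dist_real_def)
qed

lemma c_min_eqI: "U m = c \<Longrightarrow> (\<And>q. c \<le> U q) \<Longrightarrow> c_min U = c"
  unfolding c_min_def by (intro cInf_eq_minimum) auto

lemma c_max_eqI: "U M = c \<Longrightarrow> (\<And>q. U q \<le> c) \<Longrightarrow> c_max U = c"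
  unfolding c_max_def by (intro cSup_eq_maximum) auto

text \<open>For a fixed point of the curve of \<open>U\<close> only the \<open>F2\<close> component
  moves with the shift. Used at the maximum, as the quotient version that follows is used at the
  minimum.\<close>

lemma negligible_not_typical_slope:
  assumes "k \<noteq> 0"
  shows "negligible {b. x + b > 0 \<and> \<not> typical (1 / (2 * sqrt (x + b) * k))}"
proof -
  have "negligible {b \<in> {b. x + b > 0}. 1 / (2 * sqrt (x + b) * k) \<in> {\<alpha>. \<not> typical \<alpha>}}"
  proof (rule negligible_nondegenerate_vimage[OF negligible_not_typical])
    fix b assume "b \<in> {b. x + b > 0}"
    then have b: "sqrt (x + b) > 0" "x + b > 0" by auto
    let ?D = "- (inverse (2 * sqrt (x + b) * k) * (inverse (sqrt (x + b)) * k) * inverse (2 * sqrt (x + b) * k))"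
    have "((\<lambda>b. 2 * sqrt (x + b) * k) has_real_derivative inverse (sqrt (x + b)) * k) (at b)"
      using b(2) by (auto intro!: derivative_eq_intros)
    from DERIV_inverse'[OF this] show "((\<lambda>b. 1 / (2 * sqrt (x + b) * k)) has_real_derivative ?D) (at b)"
      using b assms by (simp add: inverse_eq_divide)
    show "?D \<noteq> 0" using b assms by simp
  qed
  then show ?thesis by simp
qed

lemma negligible_not_typical_quotient:
  assumes "k \<noteq> 0"
  shows "negligible {b. x + b > 0 \<and> \<not> typical (sqrt (x + b) / k)}"
proof -
  have "negligible {b \<in> {b. x + b > 0}. sqrt (x + b) / k \<in> {\<alpha>. \<not> typical \<alpha>}}"
    using assms
    by (intro negligible_nondegenerate_vimage[OF negligible_not_typical,
          of _ _ "\<lambda>b. inverse (sqrt (x + b)) / 2 / k"])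
       (auto intro!: derivative_eq_intros)
  then show ?thesis by simp
qed

lemma has_real_derivative_shift_within:
  assumes "(f has_real_derivative D) (at (c - b) within (\<lambda>x. x - b) ` S)"
  shows "((\<lambda>x. f (x - b)) has_real_derivative D) (at c within S)"
proof -
  have "((\<lambda>x. x - b) has_real_derivative 1) (at c within S)" by (auto intro!: derivative_eq_intros)
  from DERIV_image_chain[OF assms this] show ?thesis by (simp add: o_def)
qed

lemma has_real_derivative_shift:
  "(f has_real_derivative D) (at (c - b)) \<Longrightarrow> ((\<lambda>x. f (x - b)) has_real_derivative D) (at c)"
  for f :: "real \<Rightarrow> real"
  using DERIV_shift[of f D c "- b"] by simp

text \<open>The interface between the measure argument and the analysis of \<open>F1\<close>.
  Derivatives at \<open>c1\<close> are one-sided; \<open>blowup\<close> keeps the zeros of the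
  curvature away from \<open>c2\<close>, and \<open>cont\<close> gives the same at \<open>c1\<close>
  once one value of the shift is excluded.\<close>

locale regular_F1 =
  fixes U f1 f2 f3 :: "real \<Rightarrow> real" and c1 c2 m M :: real
  assumes c: "0 < c2" "c2 < c1" and mM: "U m = c2" "\<And>q. c2 \<le> U q" "U M = c1" "\<And>q. U q \<le> c1"
    and upper1: "\<And>x. x \<in> {c2<..c1} \<Longrightarrow> (F1 U has_real_derivative f1 x) (at x within {c2<..c1})"
    and upper2: "\<And>x. x \<in> {c2<..c1} \<Longrightarrow> (f1 has_real_derivative f2 x) (at x within {c2<..c1})"
    and upper3: "\<And>x. x \<in> {c2<..<c1} \<Longrightarrow> (f2 has_real_derivative f3 x) (at x)"
    and cont: "continuous (at c1 within {c2<..c1}) f2"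
    and neg: "\<And>x. x \<in> {c2<..c1} \<Longrightarrow> f1 x < 0"
    and blowup: "\<And>K. \<forall>\<^sub>F x in at_right c2. K * (- f1 x) < f2 x"
    and lower1: "\<And>x. x < c2 \<Longrightarrow> (F1 U has_real_derivative f1 x) (at x)"
    and lower2: "\<And>x. x < c2 \<Longrightarrow> (f1 has_real_derivative f2 x) (at x)"
    and lower_neg: "\<And>x. x < c2 \<Longrightarrow> f1 x < 0" "\<And>x. x < c2 \<Longrightarrow> f2 x < 0"
    and F1_pos: "F1 U c2 > 0"
begin

text \<open>The last three sets belong to the end point \<open>c1\<close>, where \<open>f2\<close> need not be differentiable,
  and to the two slopes at \<open>c1\<close> and \<open>c2\<close>.\<close>

definition bad_shifts :: "real set" where
  "bad_shifts =
     {b. \<exists>x\<in>{c2<..<c1}. x + b > 0 \<and> f1 x + 2 * (x + b) * f2 x = 0 \<and>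
        (3 * f2 x + 2 * (x + b) * f3 x = 0 \<or> \<not> typical (1 / (2 * sqrt (x + b) * f1 x)))} \<union>
     {b. f1 c1 + 2 * (c1 + b) * f2 c1 = 0} \<union>
     {b. c1 + b > 0 \<and> \<not> typical (1 / (2 * sqrt (c1 + b) * f1 c1))} \<union>
     {b. c2 + b > 0 \<and> \<not> typical (sqrt (c2 + b) / F1 U c2)}"

lemma has_derivative_interior:
  assumes "x \<in> {c2<..<c1}" shows "(f1 has_real_derivative f2 x) (at x)"
proof -
  have "at x within {c2<..c1} = at x"
    by (rule at_within_nhd[of _ "{c2<..<c1}"]) (use assms in auto)
  then show ?thesis using upper2[of x] assms by simp
qed

lemma negligible_bad_shifts: "negligible bad_shifts"
proof -
  have f1c1: "f1 c1 < 0" using neg c by simp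
  \<comment> \<open>The condition is affine in \<open>b\<close>, and it has no solution when
    \<open>f2 c1 = 0\<close> because \<open>f1 c1 < 0\<close>.\<close>
  have "{b. f1 c1 + 2 * (c1 + b) * f2 c1 = 0} \<subseteq> {- f1 c1 / (2 * f2 c1) - c1}"
  proof
    fix b assume "b \<in> {b. f1 c1 + 2 * (c1 + b) * f2 c1 = 0}"
    then have *: "f1 c1 + 2 * (c1 + b) * f2 c1 = 0" by simp
    then have "f2 c1 \<noteq> 0" using f1c1 by auto
    then show "b \<in> {- f1 c1 / (2 * f2 c1) - c1}" using * by (simp add: field_simps)
  qed
  then have "negligible {b. f1 c1 + 2 * (c1 + b) * f2 c1 = 0}"
    by (rule negligible_subset[rotated]) simp
  then show ?thesis unfolding bad_shifts_def using f1c1 F1_pos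
    by (intro negligible_Un negligible_degenerate_shifts negligible_not_typical_slope
        negligible_not_typical_quotient)
       (auto intro: has_derivative_interior upper3 neg)
qed

section \<open>The curvature of a single shifted potential\<close>

context
  fixes b :: real and V :: "real \<Rightarrow> real"
  assumes b: "b > 0" "b \<notin> bad_shifts" and V: "V = (\<lambda>q. U q + b)"
begin

lemma cV: "c_min V = c2 + b" "c_max V = c1 + b"
  using c_min_eqI[of V m "c2 + b"] c_max_eqI[of V M "c1 + b"] mM by (auto simp: V)

lemma less_V: "c_min V < c_max V" using cV c by simp

lemma domain_V: "curve_domain V = {0..<c2 + b} \<union> {c2 + b<..c1 + b}"
  by (simp add: curve_domain_def cV)

lemma shifted_derivative:
  assumes x: "x \<in> curve_domain V"
    and up: "\<And>x. x \<in> {c2<..c1} \<Longrightarrow> (g has_real_derivative g' x) (at x within {c2<..c1})"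
    and low: "\<And>x. x < c2 \<Longrightarrow> (g has_real_derivative g' x) (at x)"
  shows "((\<lambda>c. g (c - b)) has_real_derivative g' (x - b)) (at x within curve_domain V)"
proof (cases "x < c2 + b")
  case True
  then show ?thesis
    by (intro has_field_derivative_at_within[OF has_real_derivative_shift] low) simp
next
  case False
  then have xx: "x \<in> {c2 + b<..c1 + b}" using x by (auto simp: domain_V)
  have "(\<lambda>x. x - b) ` {c2 + b<..c1 + b} = {c2<..c1}"
    by (auto simp: image_iff intro!: bexI[of _ "_ + b"])
  then show ?thesis using up[of "x - b"] xx
    unfolding at_within_curve_domain_upper[of x V, unfolded cV, OF xx]
    by (intro has_real_derivative_shift_within) simp
qed

lemma dc_F1: "x \<in> curve_domain V \<Longrightarrow> dc V (F1 V) x = f1 (x - b)"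
  using shifted_derivative[of x "F1 U" f1] upper1 lower1
  by (intro dc_eqI less_V) (simp_all add: V F1_add_const[abs_def])

lemma dc_dc_F1: "x \<in> curve_domain V \<Longrightarrow> dc V (dc V (F1 V)) x = f2 (x - b)"
proof (intro dc_eqI less_V)
  assume x: "x \<in> curve_domain V"
  show "(dc V (F1 V) has_real_derivative f2 (x - b)) (at x within curve_domain V)"
    by (rule has_field_derivative_transform_within[OF shifted_derivative[OF x upper2 lower2], of 1])
       (use x dc_F1 in auto)
qed

text \<open>Extracting the derivatives of \<open>F2\<close> splits \<open>kappa V\<close> into
  \<open>curv_num\<close> and a factor without zeros, so zeros and their orders can be read off from
  \<open>curv_num\<close>.\<close>

definition "curv_num x = f1 (x - b) + 2 * x * f2 (x - b)"
definition "curv_fac x = - 1 / (4 * (x * sqrt x)) / (((f1 (x - b))\<^sup>2 + (1 / (2 * sqrt x))\<^sup>2) powr (3 / 2))"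

lemma kappa_V: assumes "x \<in> curve_domain V" "x > 0" shows "kappa V x = curv_num x * curv_fac x"
proof -
  have "kappa V x = (- 1 / (4 * (x * sqrt x)) * f1 (x - b) - f2 (x - b) * (1 / (2 * sqrt x))) /
      (((f1 (x - b))\<^sup>2 + (1 / (2 * sqrt x))\<^sup>2) powr (3 / 2))"
    unfolding kappa_def using dc_F1 dc_dc_F1 dc_F2[OF less_V] dc_dc_F2[OF less_V] assms by simp
  also have "- 1 / (4 * (x * sqrt x)) * f1 (x - b) - f2 (x - b) * (1 / (2 * sqrt x))
     = curv_num x * (- 1 / (4 * (x * sqrt x)))"
    using assms(2) by (simp add: curv_num_def field_simps)
  finally show ?thesis by (simp add: curv_fac_def)
qed

lemma curv_fac_nonzero: "x > 0 \<Longrightarrow> curv_fac x \<noteq> 0"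
  unfolding curv_fac_def by (auto simp: add_nonneg_eq_0_iff)

lemma kappa_zero_iff: "x \<in> curve_domain V \<Longrightarrow> x > 0 \<Longrightarrow> kappa V x = 0 \<longleftrightarrow> curv_num x = 0"
  using kappa_V curv_fac_nonzero by simp

text \<open>Below the minimum both terms of \<open>curv_num\<close> are negative, and at the top its
  value is nonzero by the choice of \<open>b\<close>.\<close>

lemma kappa_zero_interior:
  assumes "x \<in> curve_domain V" "x > 0" "kappa V x = 0"
  shows "x - b \<in> {c2<..<c1}"
proof -
  have curv_num: "curv_num x = 0" using assms kappa_zero_iff by simp
  have "\<not> x < c2 + b"
  proof
    assume "x < c2 + b"
    then have "f1 (x - b) < 0" "2 * x * f2 (x - b) < 0"
      using lower_neg[of "x - b"] assms(2) by (auto intro: mult_pos_neg)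
    then show False using curv_num by (simp add: curv_num_def)
  qed
  moreover have "x \<noteq> c1 + b"
    using curv_num b(2) by (auto simp: curv_num_def bad_shifts_def)
  ultimately show ?thesis using assms(1) by (auto simp: domain_V)
qed

lemma DERIV_curv_num:
  assumes "x - b \<in> {c2<..<c1}"
  shows "(curv_num has_real_derivative 3 * f2 (x - b) + 2 * x * f3 (x - b)) (at x)"
proof -
  have "((\<lambda>x. f1 (x - b)) has_real_derivative f2 (x - b)) (at x)"
    "((\<lambda>x. f2 (x - b)) has_real_derivative f3 (x - b)) (at x)"
    by (rule has_real_derivative_shift[OF has_derivative_interior[OF assms]],
        rule has_real_derivative_shift[OF upper3[OF assms]])
  then show ?thesis unfolding curv_num_def[abs_def]
    by (auto intro!: derivative_eq_intros)
qed

lemma curv_num_zero: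
  assumes "x - b \<in> {c2<..<c1}" "curv_num x = 0"
  shows "3 * f2 (x - b) + 2 * x * f3 (x - b) \<noteq> 0" "typical (1 / (2 * sqrt x * f1 (x - b)))"
proof -
  have "x > 0" using assms(1) b c by auto
  then have *: "\<not> (3 * f2 (x - b) + 2 * x * f3 (x - b) = 0 \<or> \<not> typical (1 / (2 * sqrt x * f1 (x - b))))"
    using b(2) assms unfolding bad_shifts_def curv_num_def by (auto dest!: bspec[of _ _ "x - b"])
  then show "3 * f2 (x - b) + 2 * x * f3 (x - b) \<noteq> 0" "typical (1 / (2 * sqrt x * f1 (x - b)))"
    by auto
qed

lemma DERIV_kappa:
  assumes "x \<in> curve_domain V" "x > 0" "kappa V x = 0"
  shows "\<exists>D. D \<noteq> 0 \<and> (kappa V has_real_derivative D) (at x within curve_domain V)"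
proof -
  note i = kappa_zero_interior[OF assms]
  have curv_num: "curv_num x = 0" using kappa_zero_iff assms by simp
  define P' where "P' = 3 * f2 (x - b) + 2 * x * f3 (x - b)"
  have P': "(curv_num has_real_derivative P') (at x)" "P' \<noteq> 0"
    using DERIV_curv_num[OF i] curv_num_zero(1)[OF i curv_num] by (simp_all add: P'_def)
  have f: "((\<lambda>x. f1 (x - b)) has_real_derivative f2 (x - b)) (at x)"
    by (rule has_real_derivative_shift[OF has_derivative_interior[OF i]])
  have pos: "(f1 (x - b))\<^sup>2 + (1 / (2 * sqrt x))\<^sup>2 > 0"
    using assms(2) by (intro add_nonneg_pos) auto
  have nz: "2 * sqrt x \<noteq> 0" "4 * (x * sqrt x) \<noteq> 0" using assms(2) by auto
  note sq = DERIV_real_sqrt[OF assms(2)]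
  note G = DERIV_add[OF DERIV_power[OF f, of 2]
      DERIV_power[OF DERIV_divide[OF DERIV_const[of 1] DERIV_cmult[OF sq, of 2] nz(1)], of 2]]
  have pw: "((f1 (x - b))\<^sup>2 + (1 / (2 * sqrt x))\<^sup>2) powr (3 / 2) \<noteq> 0" using pos by auto
  \<comment> \<open>The mere existence of \<open>Q'\<close> is enough: in the product rule it is
    multiplied by \<open>curv_num x = 0\<close>.\<close>
  obtain Q' where "(curv_fac has_real_derivative Q') (at x)"
    unfolding curv_fac_def[abs_def]
    using DERIV_divide[OF DERIV_divide[OF DERIV_const[of "-1"] DERIV_cmult[OF DERIV_mult[OF DERIV_ident sq], of 4] nz(2)]
       DERIV_chain2[OF has_real_derivative_powr[OF pos, of "3/2"] G] pw] by blast
  from DERIV_mult[OF P'(1) this] have "((\<lambda>x. curv_num x * curv_fac x) has_real_derivative P' * curv_fac x) (at x)"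
    using curv_num by simp
  then have "((\<lambda>x. curv_num x * curv_fac x) has_real_derivative P' * curv_fac x) (at x within curve_domain V)"
    by (rule has_field_derivative_at_within)
  then have "(kappa V has_real_derivative P' * curv_fac x) (at x within curve_domain V)"
    by (rule has_field_derivative_transform_within[OF _ assms(2,1)]) (auto simp: kappa_V dist_real_def)
  then show ?thesis using P'(2) curv_fac_nonzero[OF assms(2)] by (intro exI[of _ "P' * curv_fac x"]) simp
qed

text \<open>Three reasons for the three kinds of points: \<open>f2\<close> outgrows
  \<open>f1\<close> at the lower end, continuity and a nonzero value hold at the upper end, and
  zeros in between are simple.\<close>

lemma curv_num_eventually_nonzero:
  assumes "z \<in> {c2 + b..c1 + b}"
  shows "\<forall>\<^sub>F x in at z within {c2 + b<..c1 + b}. curv_num x \<noteq> 0"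
proof -
  consider "z = c2 + b" | "z = c1 + b" | "z - b \<in> {c2<..<c1}" using assms by fastforce
  then show ?thesis
  proof cases
    case 1
    have "\<forall>\<^sub>F x in at_right c2. f1 x + 2 * (x + b) * f2 x \<noteq> 0"
      \<comment> \<open>This constant turns the blow-up into \<open>- f1 x < 2 * c2 * f2 x\<close>,
        and \<open>c2 < x + b\<close>.\<close>
      using blowup[of "1 / (2 * c2)"] eventually_at_right_less[of c2]
        eventually_at_right_real[OF c(2)]
    proof eventually_elim
      case (elim x)
      then have n: "- f1 x > 0" using neg[of x] by simp
      then have "f2 x > 0" using elim(1) c(1) by (smt (verit) divide_pos_pos mult_pos_pos)
      then have "2 * c2 * f2 x < 2 * (x + b) * f2 x"
        using elim(2) b by simp
      moreover have "- f1 x < 2 * c2 * f2 x" using elim(1) c(1) by (simp add: field_simps)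
      ultimately show ?case by linarith
    qed
    then have "\<forall>\<^sub>F x in at_right z. curv_num x \<noteq> 0"
      unfolding curv_num_def 1 at_right_to_0[of "c2 + b"] at_right_to_0[of c2] by (simp add: eventually_filtermap algebra_simps)
    then show ?thesis by (rule filter_leD[OF at_le, rotated]) (auto simp: 1)
  next
    case 2
    have "(\<lambda>x. x - b) ` {c2 + b<..c1 + b} = {c2<..c1}"
      by (auto simp: image_iff intro!: bexI[of _ "_ + b"])
    moreover have "continuous (at (c1 + b) within {c2 + b<..c1 + b}) (\<lambda>x. x - b)"
      by (intro continuous_intros)
    ultimately have "continuous (at (c1 + b) within {c2 + b<..c1 + b}) (\<lambda>x. f2 (x - b))"
      using continuous_within_compose2[of "c1 + b" "{c2 + b<..c1 + b}" "\<lambda>x. x - b" f2] cont by simp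
    moreover have "continuous (at (c1 + b) within {c2 + b<..c1 + b}) (\<lambda>x. f1 (x - b))"
      using shifted_derivative[OF _ upper2 lower2, of "c1 + b"] c
        at_within_curve_domain_upper[of "c1 + b" V] by (auto simp: cV domain_V intro: DERIV_continuous)
    ultimately have "continuous (at (c1 + b) within {c2 + b<..c1 + b}) curv_num"
      unfolding curv_num_def[abs_def] by (intro continuous_intros)
    then have "(curv_num \<longlongrightarrow> curv_num (c1 + b)) (at (c1 + b) within {c2 + b<..c1 + b})"
      by (simp add: continuous_within)
    moreover have "curv_num (c1 + b) \<noteq> 0" using b(2) by (auto simp: curv_num_def bad_shifts_def)
    ultimately show ?thesis unfolding 2 by (rule tendsto_imp_eventually_ne)
  next
    case 3
    have "\<forall>\<^sub>F x in at z. curv_num x \<noteq> 0"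
    proof (cases "curv_num z = 0")
      case True
      have "((\<lambda>x. (curv_num x - curv_num z) / (x - z)) \<longlongrightarrow> 3 * f2 (z - b) + 2 * z * f3 (z - b)) (at z)"
        using DERIV_curv_num[OF 3] by (simp add: has_field_derivative_iff)
      from tendsto_imp_eventually_ne[OF this curv_num_zero(1)[OF 3 True]]
      show ?thesis by eventually_elim (auto simp: True)
    next
      case False
      have "(curv_num \<longlongrightarrow> curv_num z) (at z)" using DERIV_curv_num[OF 3] DERIV_isCont isContD by blast
      then show ?thesis using False by (rule tendsto_imp_eventually_ne)
    qed
    then show ?thesis by (rule filter_leD[OF at_le, rotated]) auto
  qed
qed

text \<open>Infinitely many zeros would accumulate in the compact closed interval. This is why the
  previous lemma includes the end point \<open>c2 + b\<close>, which lies outside the curve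
  domain.\<close>

lemma finite_kappa_zeros: "finite {x \<in> {c2 + b<..c1 + b}. kappa V x = 0}"
proof -
  let ?Z = "{x \<in> {c2 + b<..c1 + b}. kappa V x = 0}"
  have "\<not> z islimpt ?Z" if "z \<in> {c2 + b..c1 + b}" for z
  proof -
    have "\<forall>\<^sub>F x in at z. x \<in> {c2 + b<..c1 + b} \<longrightarrow> curv_num x \<noteq> 0"
      using curv_num_eventually_nonzero[OF that] by (simp add: eventually_at_filter)
    then have "\<forall>\<^sub>F x in at z. x \<notin> ?Z"
    proof eventually_elim
      case (elim x)
      then show ?case using kappa_zero_iff[of x] b c by (auto simp: domain_V)
    qed
    then show ?thesis by (simp add: islimpt_iff_eventually)
  qed
  then have "finite ({c2 + b..c1 + b} \<inter> ?Z)" by (intro finite_not_islimpt_in_compact) auto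
  then show ?thesis by (rule finite_subset[rotated]) auto
qed

lemma nondegenerate_shift:
  assumes "V \<in> Omega_rev" shows "nondegenerate_metric (revolution_metric V)"
  unfolding nondegenerate_metric_def
proof (intro bexI[OF _ assms] conjI ballI impI refl)
  have c1: "c1 + b \<in> curve_domain V" "c1 + b > 0" using c b by (auto simp: domain_V)
  show "finite {c \<in> {c_min V<..c_max V}. kappa V c = 0}" using finite_kappa_zeros by (simp add: cV)
  show "\<exists>D. D \<noteq> 0 \<and> (kappa V has_real_derivative D) (at x within curve_domain V)"
    if "x \<in> {c_min V<..c_max V}" "kappa V x = 0" for x
    using that c b by (intro DERIV_kappa) (auto simp: cV domain_V)
  show "typical (dc V F2 x / dc V (F1 V) x)" if "x \<in> curve_domain V - {0}" "kappa V x = 0" for x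
  proof -
    have x: "x \<in> curve_domain V" "x > 0" using that c b by (auto simp: domain_V)
    note i = kappa_zero_interior[OF x that(2)]
    show ?thesis using curv_num_zero(2)[OF i] kappa_zero_iff[OF x] that(2)
      by (simp add: dc_F2[OF less_V x] dc_F1[OF x(1)])
  qed
  show "typical (dc V F2 (c_max V) / dc V (F1 V) (c_max V))"
    using b(2) c1 unfolding cV dc_F2[OF less_V c1] dc_F1[OF c1(1)] by (auto simp: bad_shifts_def)
  have "F1 V (c_min V) = F1 U c2" unfolding cV(1) by (simp add: V F1_add_const)
  then show "typical (F2 (c_min V) / F1 V (c_min V))"
    using b c by (auto simp: cV F2_def bad_shifts_def)
qed

end

end

lemma exists_positive_not_negligible:
  assumes "negligible S" "e > 0" obtains b :: real where "0 < b" "b < e" "b \<notin> S"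
proof -
  have "\<not> {0<..<e} \<subseteq> S"
    using assms negligible_subset[OF assms(1)] open_not_negligible[of "{0<..<e}"] by auto
  then obtain b where "b \<in> {0<..<e}" "b \<notin> S" by blast
  then show ?thesis by (intro that[of b]) auto
qed

subsection \<open>Potentials with one minimum and one maximum per period\<close>

text \<open>The period is read from minimum to minimum, so \<open>M\<close> may lie beyond 1; in
  exchange \<open>U\<close> rises on all of \<open>{m..M}\<close> and falls on all of
  \<open>{M..m + 1}\<close>.\<close>

locale profile =
  fixes U U1 U2 :: "real \<Rightarrow> real" and m M :: real
  assumes dU: "\<And>q. (U has_real_derivative U1 q) (at q)"
    and dU1: "\<And>q. (U1 has_real_derivative U2 q) (at q)"
    and smooth: "\<And>n. Cdiff n U2 UNIV"
    and periodic: "\<And>q. U (q + 1) = U q"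
    and order: "0 \<le> m" "m < 1" "m < M" "M < m + 1"
    and critical: "U1 M = 0"
    and increasing: "\<And>q. q \<in> {m<..<M} \<Longrightarrow> U1 q > 0"
    and decreasing: "\<And>q. q \<in> {M<..<m + 1} \<Longrightarrow> U1 q < 0"
    and U2_min: "U2 m > 0" and U2_max: "U2 M < 0"
    and pos: "\<And>q. U q > 0"
begin

lemma continuous_U: "continuous_on A U"
  by (meson DERIV_imp_continuous_on dU)

lemma U_end: "U (m + 1) = U m" by (rule periodic)

lemma U_strict_increasing: "m \<le> a \<Longrightarrow> a < b \<Longrightarrow> b \<le> M \<Longrightarrow> U a < U b"
proof (rule DERIV_pos_imp_increasing_open[where f = U])
  fix x assume *: "m \<le> a" "a < b" "b \<le> M" "a < x" "x < b"
  show "\<exists>y. (U has_real_derivative y) (at x) \<and> 0 < y"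
    using dU[of x] increasing[of x] * by (intro exI[of _ "U1 x"]) simp
qed (use continuous_U in auto)

lemma U_strict_decreasing: "M \<le> a \<Longrightarrow> a < b \<Longrightarrow> b \<le> m + 1 \<Longrightarrow> U b < U a"
proof (rule DERIV_neg_imp_decreasing_open[where f = U])
  fix x assume *: "M \<le> a" "a < b" "b \<le> m + 1" "a < x" "x < b"
  show "\<exists>y. (U has_real_derivative y) (at x) \<and> y < 0"
    using dU[of x] decreasing[of x] * by (intro exI[of _ "U1 x"]) simp
qed (use continuous_U in auto)

lemma U_min_period: "q \<in> {m<..<m + 1} \<Longrightarrow> U m < U q"
  using U_strict_increasing[of m q] U_strict_decreasing[of q "m + 1"] U_end order
  by (cases "q \<le> M") auto

lemma U_max_period: "q \<in> {m..m + 1} \<Longrightarrow> q \<noteq> M \<Longrightarrow> U q < U M"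
  using U_strict_increasing[of q M] U_strict_decreasing[of M q] order
  by (cases "q \<le> M") auto

lemma range_period: obtains q' where "q' \<in> {m..<m + 1}" "U q' = U q"
proof -
  interpret U: periodic_fun_simple' U by unfold_locales (rule periodic)
  have "U (m + frac (q - m)) = U ((m + frac (q - m)) + of_int \<lfloor>q - m\<rfloor>)"
    by (rule U.plus_of_int[symmetric])
  also have "(m + frac (q - m)) + of_int \<lfloor>q - m\<rfloor> = q" by (simp add: frac_def)
  finally show ?thesis using frac_ge_0[of "q - m"] frac_lt_1[of "q - m"]
    by (intro that[of "m + frac (q - m)"]) auto
qed

lemma U_bounds: "U m \<le> U q" "U q \<le> U M"
proof -
  obtain q' where q': "q' \<in> {m..<m + 1}" "U q' = U q" by (rule range_period)
  show "U m \<le> U q" using U_min_period[of q'] q' by (cases "q' = m") auto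
  show "U q \<le> U M" using U_max_period[of q'] q' by (cases "q' = M") auto
qed

lemma U_min_less_max: "U m < U M" using U_min_period[of M] order by simp

text \<open>Taylor's formula at \<open>M\<close>: \<open>g\<close> is the smooth quotient of \<open>U M - U (M + x)\<close> by \<open>x\<^sup>2\<close>, so that
  \<open>y\<close> below is a coordinate in which \<open>U\<close> becomes \<open>U M - y\<^sup>2\<close>; \<open>psi\<close> is its inverse.\<close>

definition g :: "real \<Rightarrow> real" where
  "g x = - 1 * integral {0..1} (\<lambda>t. (1 - t) * U2 (M + t * x))"

lemma Cdiff_g: "Cdiff n g UNIV"
proof -
  have "Cdiff n (\<lambda>z. U2 (M + z)) UNIV"
    by (rule Cdiff_compose[OF smooth Cdiff_add[OF Cdiff_const Cdiff_ident]]) simp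
  then have "Cdiff n (\<lambda>x. integral {0..1} (\<lambda>t. (1 - t) * U2 (M + t * x))) UNIV"
    by (rule Cdiff_integral_scaled) (auto intro!: continuous_intros)
  then show ?thesis unfolding g_def[abs_def] by (rule Cdiff_mult[OF Cdiff_const])
qed

lemma g_eq: "x\<^sup>2 * g x = U M - U (M + x)"
proof -
  \<comment> \<open>Primitive of the Taylor remainder: its value is \<open>U (M + x)\<close> at
    \<open>t = 1\<close>, and \<open>U M\<close> at \<open>t = 0\<close> because
    \<open>U1 M = 0\<close>.\<close>
  let ?F = "\<lambda>t. (1 - t) * x * U1 (M + t * x) + U (M + t * x)"
  have "((\<lambda>t. x\<^sup>2 * ((1 - t) * U2 (M + t * x))) has_integral ?F 1 - ?F 0) {0..1}"
  proof (rule fundamental_theorem_of_calculus)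
    fix t :: real
    have l: "((\<lambda>t. M + t * x) has_real_derivative x) (at t)" by (auto intro!: derivative_eq_intros)
    note D = DERIV_chain2[OF dU l] DERIV_chain2[OF dU1 l]
    have "((\<lambda>t. (1 - t) * x) has_real_derivative - x) (at t)" by (auto intro!: derivative_eq_intros)
    from DERIV_add[OF DERIV_mult[OF this D(2)] D(1)]
    have "(?F has_real_derivative x\<^sup>2 * ((1 - t) * U2 (M + t * x))) (at t)"
      by (simp add: algebra_simps power2_eq_square)
    then show "(?F has_vector_derivative x\<^sup>2 * ((1 - t) * U2 (M + t * x))) (at t within {0..1})"
      by (simp add: has_real_derivative_iff_has_vector_derivative has_vector_derivative_at_within)
  qed simp
  then have "x\<^sup>2 * integral {0..1} (\<lambda>t. (1 - t) * U2 (M + t * x)) = U (M + x) - U M"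
    using critical by (simp add: integral_unique flip: integral_mult_right)
  then show ?thesis by (simp add: g_def)
qed

lemma g_0: "g 0 = - U2 M / 2"
proof -
  have "((\<lambda>t::real. (1 - t)) has_integral (1 - 1\<^sup>2 / 2) - (0 - 0\<^sup>2 / 2)) {0..1}"
    by (rule fundamental_theorem_of_calculus)
       (auto intro!: derivative_eq_intros simp: has_real_derivative_iff_has_vector_derivative[symmetric])
  then have "((\<lambda>t::real. (1 - t) * U2 M) has_integral (1 / 2) * U2 M) {0..1}"
    by (intro has_integral_mult_left) simp
  from integral_unique[OF this] show ?thesis by (simp add: g_def del: integral_mult_left)
qed

lemma g_pos: assumes "x \<in> {m - M..m + 1 - M}" shows "g x > 0"
proof (cases "x = 0")
  case True then show ?thesis using g_0 U2_max by simp
next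
  case False
  then have "x\<^sup>2 * g x > 0" unfolding g_eq using U_max_period[of "M + x"] assms by simp
  then show ?thesis by (simp add: zero_less_mult_iff)
qed

definition J :: "real set" where "J = {m - M<..<m + 1 - M}"

definition y :: "real \<Rightarrow> real" where "y x = x * sqrt (g x)"

abbreviation "y1 \<equiv> deriv y"

lemma open_J: "open J" and zero_J: "0 \<in> J" and J_closed: "x \<in> J \<Longrightarrow> x \<in> {m - M..m + 1 - M}"
  using order by (auto simp: J_def)

lemma Cdiff_sqrt_g: "Cdiff n (\<lambda>x. sqrt (g x)) J"
proof (rule Cdiff_compose[OF Cdiff_sqrt])
  show "Cdiff n g J" using Cdiff_g by (rule Cdiff_subset) simp
  show "g ` J \<subseteq> {0<..}" using g_pos J_closed by auto
qed

lemma Cdiff_y: "Cdiff n y J"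
  unfolding y_def[abs_def] by (rule Cdiff_mult[OF Cdiff_ident Cdiff_sqrt_g])

lemma Cdiff_y1: "Cdiff n y1 J"
  by (rule Cdiff_deriv(1)[OF open_J Cdiff_y])

lemma DERIV_y: "x \<in> J \<Longrightarrow> (y has_real_derivative y1 x) (at x)"
  by (rule Cdiff_deriv(2)[OF open_J Cdiff_y])

lemma y_squared: "x \<in> {m - M..m + 1 - M} \<Longrightarrow> (y x)\<^sup>2 = U M - U (M + x)"
  using g_pos[of x] by (simp add: y_def power_mult_distrib g_eq[symmetric])

text \<open>Differentiating \<open>(y x)^2 = U M - U (M + x)\<close> gives
  \<open>2 * y x * y1 x = - U1 (M + x)\<close>, where the signs are known for
  \<open>x \<noteq> 0\<close>. At 0 this says nothing, and the product form of \<open>y\<close>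
  yields \<open>sqrt (g 0)\<close> instead.\<close>

lemma y1_pos: assumes "x \<in> J" shows "y1 x > 0"
proof (cases "x = 0")
  case True
  obtain d where d: "\<And>x. x \<in> J \<Longrightarrow> ((\<lambda>x. sqrt (g x)) has_real_derivative d x) (at x)"
    by (rule Cdiff_SucE[OF Cdiff_sqrt_g[of "Suc 0"]]) blast
  have "(y has_real_derivative sqrt (g 0)) (at 0)"
    unfolding y_def[abs_def] using DERIV_mult[OF DERIV_ident d[OF zero_J]] by simp
  then have "y1 0 = sqrt (g 0)" by (rule DERIV_imp_deriv)
  then show ?thesis using True g_pos[of 0] order by simp
next
  case False
  have "((\<lambda>x. (y x)\<^sup>2) has_real_derivative 2 * y x * y1 x) (at x)"
    using DERIV_power[OF DERIV_y[OF assms], of 2] by (simp add: mult_ac)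
  moreover have "((\<lambda>x. M + x) has_real_derivative 1) (at x)"
    by (auto intro!: derivative_eq_intros)
  from DERIV_diff[OF DERIV_const DERIV_chain2[OF dU this]]
  have "((\<lambda>x. U M - U (M + x)) has_real_derivative - U1 (M + x)) (at x)" by simp
  then have "((\<lambda>x. (y x)\<^sup>2) has_real_derivative - U1 (M + x)) (at x)"
    by (rule has_field_derivative_transform_within_open[OF _ open_J assms])
       (rule y_squared[symmetric, OF J_closed])
  ultimately have eq: "2 * y x * y1 x = - U1 (M + x)" by (rule DERIV_unique)
  show ?thesis
  proof (cases "x > 0")
    case True
    then have "y x > 0" using g_pos J_closed[OF assms] by (simp add: y_def)
    moreover have "U1 (M + x) < 0" using decreasing[of "M + x"] assms True by (simp add: J_def)
    ultimately have "y1 x * (2 * y x) > 0" "2 * y x > 0" using eq by (simp_all add: mult_ac)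
    then show ?thesis by (metis zero_less_mult_pos2)
  next
    case neg: False
    then have "y x < 0" using g_pos J_closed[OF assms] False by (simp add: y_def mult_neg_pos)
    moreover have "U1 (M + x) > 0" using increasing[of "M + x"] assms neg False by (simp add: J_def)
    ultimately have "y1 x * (2 * y x) < 0" "2 * y x < 0" using eq by (simp_all add: mult_ac)
    then show ?thesis by (simp add: mult_less_0_iff)
  qed
qed

lemma continuous_y: "continuous_on A y"
  unfolding y_def[abs_def]
  by (intro continuous_intros continuous_on_subset[OF Cdiff_imp_continuous_on[OF Cdiff_g]]) auto

lemma y_strict_mono: "a < b \<Longrightarrow> a \<in> {m - M..m + 1 - M} \<Longrightarrow> b \<in> {m - M..m + 1 - M} \<Longrightarrow> y a < y b"
proof (rule DERIV_pos_imp_increasing_open[where f = y])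
  fix x assume "a < b" "a \<in> {m - M..m + 1 - M}" "b \<in> {m - M..m + 1 - M}" "a < x" "x < b"
  then have "x \<in> J" by (auto simp: J_def)
  then show "\<exists>d. (y has_real_derivative d) (at x) \<and> 0 < d" using DERIV_y y1_pos by blast
qed (use continuous_y in auto)

section \<open>The inverse coordinate and its derivatives\<close>

definition R :: real where "R = sqrt (U M - U m)"

lemma R_pos: "R > 0" and R_squared: "R\<^sup>2 = U M - U m"
  using U_min_less_max by (auto simp: R_def)

lemma y_left: "y (m - M) = - R" and y_right: "y (m + 1 - M) = R"
proof -
  have "sqrt ((y (m - M))\<^sup>2) = R" "sqrt ((y (m + 1 - M))\<^sup>2) = R"
    using y_squared[of "m - M"] y_squared[of "m + 1 - M"] order U_end
    unfolding R_def by simp_all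
  moreover have "y (m - M) \<le> 0" "y (m + 1 - M) \<ge> 0"
    using y_strict_mono[of "m - M" 0] y_strict_mono[of 0 "m + 1 - M"] order by (auto simp: y_def)
  ultimately show "y (m - M) = - R" "y (m + 1 - M) = R" by auto
qed

definition I :: "real set" where "I = {- R<..<R}"

lemma y_in_I: "x \<in> J \<Longrightarrow> y x \<in> I"
  using y_strict_mono[of "m - M" x] y_strict_mono[of x "m + 1 - M"] y_left y_right order
  by (auto simp: J_def I_def)

lemma I_scaled: "z \<in> I \<Longrightarrow> sin t * z \<in> I"
  using mult_right_mono[OF abs_sin_le_one[of t], of "\<bar>z\<bar>"] by (auto simp: I_def abs_mult[symmetric])

lemma open_I: "open I" and convex_I: "convex I" and zero_I: "0 \<in> I"
  using R_pos by (auto simp: I_def)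

definition psi :: "real \<Rightarrow> real" where "psi z = (SOME x. x \<in> J \<and> y x = z)"

lemma psi: assumes "z \<in> I" shows "psi z \<in> J" "y (psi z) = z"
proof -
  have "\<exists>x\<ge>m - M. x \<le> m + 1 - M \<and> y x = z"
    using assms order y_left y_right continuous_y by (intro IVT') (auto simp: I_def)
  then obtain x where x: "m - M \<le> x" "x \<le> m + 1 - M" "y x = z" by auto
  moreover have "x \<noteq> m - M" "x \<noteq> m + 1 - M" using x(3) assms y_left y_right by (auto simp: I_def)
  ultimately have "x \<in> J \<and> y x = z" by (auto simp: J_def)
  then have "psi z \<in> J \<and> y (psi z) = z" unfolding psi_def by (rule someI)
  then show "psi z \<in> J" "y (psi z) = z" by auto
qed

lemma psi_y: assumes "x \<in> J" shows "psi (y x) = x"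
proof -
  note p = psi[OF y_in_I[OF assms]]
  show ?thesis
    using p(2) y_strict_mono[of "psi (y x)" x] y_strict_mono[of x "psi (y x)"]
      J_closed[OF p(1)] J_closed[OF assms] by (metis less_irrefl linorder_neqE)
qed

lemma isCont_psi: assumes "z \<in> I" shows "isCont psi z"
proof -
  note p = psi[OF assms]
  have l: "m - M < psi z" "psi z < m + 1 - M" using p(1) by (auto simp: J_def)
  define a b where "a = (m - M + psi z) / 2" and "b = (psi z + (m + 1 - M)) / 2"
  have "isCont psi (y (psi z))"
  proof (rule isCont_inverse_function2[where f = y and a = a and b = b])
    show "a < psi z" "psi z < b" using l by (auto simp: a_def b_def)
    fix x assume "a \<le> x" "x \<le> b"
    then have "x \<in> J" using l by (auto simp: a_def b_def J_def)
    then show "psi (y x) = x" "isCont y x" using psi_y DERIV_y DERIV_isCont by blast+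
  qed
  then show ?thesis by (simp add: p(2))
qed

lemma DERIV_psi: assumes "z \<in> I" shows "(psi has_real_derivative inverse (y1 (psi z))) (at z)"
proof (rule DERIV_inverse_function[where f = y and a = "- R" and b = R])
  note p = psi[OF assms]
  show "(y has_real_derivative y1 (psi z)) (at (psi z))" "y1 (psi z) \<noteq> 0"
    using DERIV_y[OF p(1)] y1_pos[OF p(1)] by auto
  show "- R < z" "z < R" using assms by (auto simp: I_def)
  show "y (psi w) = w" if "- R < w" "w < R" for w using psi(2)[of w] that by (simp add: I_def)
qed (rule isCont_psi[OF assms])

lemma Cdiff_psi: "Cdiff n psi I"
proof (rule Cdiff_Suc_D, rule Cdiff_local_inverse[OF Cdiff_y1])
  show "psi ` I \<subseteq> J" using psi(1) by auto
  show "y1 x \<noteq> 0" if "x \<in> J" for x using y1_pos[OF that] by simp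
qed (rule DERIV_psi)

abbreviation "p1 \<equiv> deriv psi"
abbreviation "p2 \<equiv> deriv p1"

lemma Cdiff_p1: "Cdiff n p1 I"
  by (rule Cdiff_deriv(1)[OF open_I Cdiff_psi])

lemma DERIV_psi': "z \<in> I \<Longrightarrow> (psi has_real_derivative p1 z) (at z)"
  by (rule Cdiff_deriv(2)[OF open_I Cdiff_psi])

lemma Cdiff_p2: "Cdiff n p2 I"
  by (rule Cdiff_deriv(1)[OF open_I Cdiff_p1])

lemma DERIV_p1: "z \<in> I \<Longrightarrow> (p1 has_real_derivative p2 z) (at z)"
  by (rule Cdiff_deriv(2)[OF open_I Cdiff_p1])

lemma p1_pos: "z \<in> I \<Longrightarrow> p1 z > 0"
  using DERIV_imp_deriv[OF DERIV_psi] y1_pos psi(1) by simp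

lemma U_psi: assumes "z \<in> I" shows "U (M + psi z) = U M - z\<^sup>2"
  using y_squared[OF J_closed[OF psi(1)[OF assms]]] psi(2)[OF assms] by simp

lemma U1_psi: assumes "z \<in> I" shows "U1 (M + psi z) * p1 z = - 2 * z"
proof -
  have "((\<lambda>z. M + psi z) has_real_derivative p1 z) (at z)"
    using DERIV_add[OF DERIV_const DERIV_psi'[OF assms]] by simp
  from DERIV_chain2[OF dU this]
  have "((\<lambda>z. U (M + psi z)) has_real_derivative U1 (M + psi z) * p1 z) (at z)" .
  moreover have "((\<lambda>z. U M - z\<^sup>2) has_real_derivative - 2 * z) (at z)"
    by (auto intro!: derivative_eq_intros)
  then have "((\<lambda>z. U (M + psi z)) has_real_derivative - 2 * z) (at z)"
    by (rule has_field_derivative_transform_within_open[OF _ open_I assms]) (simp add: U_psi)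
  ultimately show ?thesis by (rule DERIV_unique)
qed

text \<open>\<open>U1_psi\<close> differentiated once more and multiplied by \<open>p1 z\<close>,
  which eliminates \<open>U1\<close>. Near the minimum \<open>U2\<close> is positive and the cubic
  term dominates; the blow-up of \<open>f2\<close> comes from there.\<close>

lemma p2_eq: assumes "z \<in> I" shows "2 * (z * p2 z) = 2 * p1 z + (p1 z)^3 * U2 (M + psi z)"
proof -
  have "((\<lambda>z. M + psi z) has_real_derivative p1 z) (at z)"
    using DERIV_add[OF DERIV_const DERIV_psi'[OF assms]] by simp
  from DERIV_mult[OF DERIV_chain2[OF dU1 this] DERIV_p1[OF assms]]
  have "((\<lambda>z. U1 (M + psi z) * p1 z) has_real_derivative
      U2 (M + psi z) * p1 z * p1 z + p2 z * U1 (M + psi z)) (at z)" .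
  moreover have "((\<lambda>z. - 2 * z) has_real_derivative - 2) (at z)"
    by (auto intro!: derivative_eq_intros)
  then have "((\<lambda>z. U1 (M + psi z) * p1 z) has_real_derivative - 2) (at z)"
    by (rule has_field_derivative_transform_within_open[OF _ open_I assms]) (simp add: U1_psi)
  ultimately have "U2 (M + psi z) * p1 z * p1 z + p2 z * U1 (M + psi z) = - 2" by (rule DERIV_unique)
  then have "p1 z * (U2 (M + psi z) * p1 z * p1 z + p2 z * U1 (M + psi z)) = p1 z * - 2" by simp
  moreover have "p1 z * (p2 z * U1 (M + psi z)) = p2 z * (U1 (M + psi z) * p1 z)" by simp
  then have "p1 z * (p2 z * U1 (M + psi z)) = - 2 * (z * p2 z)"
    by (simp add: U1_psi[OF assms])
  ultimately show ?thesis by (simp add: algebra_simps power3_eq_cube)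
qed

end

subsection \<open>The function \<open>F1\<close> between the critical values\<close>

text \<open>L'Hopital's rule for the difference quotient. It is meant for \<open>c = U M\<close>,
  where the square root in \<open>r = sqrt (U M - c)\<close> prevents the chain rule.\<close>

lemma has_real_derivative_from_left_limit:
  fixes f :: "real \<Rightarrow> real"
  assumes "a < c" "\<And>x. x \<in> {a<..<c} \<Longrightarrow> (f has_real_derivative f' x) (at x)"
    and "(f \<longlongrightarrow> f c) (at_left c)" "(f' \<longlongrightarrow> L) (at_left c)"
  shows "(f has_real_derivative L) (at c within {a<..c})"
proof -
  have ev: "\<forall>\<^sub>F x in at_left c. x \<in> {a<..<c}" using assms(1) by (rule eventually_at_left_real)
  have "((\<lambda>x. (f x - f c) / (x - c)) \<longlongrightarrow> L) (at_left c)"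
  proof (rule lhopital_left[where f' = f' and g' = "\<lambda>_. 1"])
    show "((\<lambda>x. f x - f c) \<longlongrightarrow> 0) (at_left c)" "((\<lambda>x. x - c) \<longlongrightarrow> 0) (at_left c)"
      using assms(3) by (auto intro!: LIM_zero tendsto_intros)
    show "\<forall>\<^sub>F x in at_left c. ((\<lambda>x. f x - f c) has_real_derivative f' x) (at x)"
      using ev by eventually_elim (auto intro!: derivative_eq_intros assms(2))
  qed (use assms(4) ev in \<open>auto intro!: derivative_eq_intros elim!: eventually_mono\<close>)
  moreover have "at c within {a<..c} = at_left c"
    by (rule at_within_nhd[of _ "{a<..}"]) (use assms(1) in auto)
  ultimately show ?thesis by (simp add: has_field_derivative_iff)
qed

context profile
begin

lemma continuous_on_arc: "continuous_on B p \<Longrightarrow> r \<in> I \<Longrightarrow> I \<subseteq> B \<Longrightarrow> continuous_on D (\<lambda>t. p (sin t * r))"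
  for p :: "real \<Rightarrow> real"
  by (rule continuous_on_compose2[of I p]) (auto intro!: continuous_intros I_scaled intro: continuous_on_subset)

lemmas continuous_p1_arc = continuous_on_arc[OF Cdiff_imp_continuous_on[OF Cdiff_p1] _ order_refl]
lemmas continuous_p2_arc = continuous_on_arc[OF Cdiff_imp_continuous_on[OF Cdiff_p2] _ order_refl]

text \<open>The substitution \<open>q = M + psi (r * sin t)\<close> with \<open>r = sqrt (U M - c)\<close> turns \<open>F1 U c\<close> into
  \<open>r\<^sup>2 * A r\<close>, and its derivative into \<open>- T r / 2\<close>.\<close>

definition A :: "real \<Rightarrow> real" where
  "A r = integral {- (pi / 2)..pi / 2} (\<lambda>t. (cos t)\<^sup>2 * p1 (sin t * r))"

definition A1 :: "real \<Rightarrow> real" where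
  "A1 r = integral {- (pi / 2)..pi / 2} (\<lambda>t. (cos t)\<^sup>2 * sin t * p2 (sin t * r))"

definition T :: "real \<Rightarrow> real" where
  "T r = integral {- (pi / 2)..pi / 2} (\<lambda>t. 1 * p1 (sin t * r))"

abbreviation "T1 \<equiv> deriv T"
abbreviation "T2 \<equiv> deriv T1"

lemma DERIV_A: "r \<in> I \<Longrightarrow> (A has_real_derivative A1 r) (at r)"
  unfolding A_def[abs_def] A1_def
  by (rule has_real_derivative_integral_scaled[OF _ _ Cdiff_imp_continuous_on[OF Cdiff_p2] open_I convex_I
      _ I_scaled DERIV_p1]) (auto intro!: continuous_intros)

lemma Cdiff_T: "Cdiff n T I"
  unfolding T_def[abs_def]
  by (rule Cdiff_integral_scaled[OF Cdiff_p1 _ _ open_I convex_I I_scaled])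
     (auto intro!: continuous_intros)

lemma Cdiff_T1: "Cdiff n T1 I"
  by (rule Cdiff_deriv(1)[OF open_I Cdiff_T])

lemma DERIV_T: "r \<in> I \<Longrightarrow> (T has_real_derivative T1 r) (at r)"
  by (rule Cdiff_deriv(2)[OF open_I Cdiff_T])

lemma DERIV_T1: "r \<in> I \<Longrightarrow> (T1 has_real_derivative T2 r) (at r)"
  by (rule Cdiff_deriv(2)[OF open_I Cdiff_T1])

lemma T1_eq: assumes "r \<in> I"
  shows "T1 r = integral {- (pi / 2)..pi / 2} (\<lambda>t. sin t * p2 (sin t * r))"
proof -
  have "(T has_real_derivative integral {- (pi / 2)..pi / 2} (\<lambda>t. 1 * sin t * p2 (sin t * r))) (at r)"
    unfolding T_def[abs_def]
    by (rule has_real_derivative_integral_scaled[OF _ _ Cdiff_imp_continuous_on[OF Cdiff_p2] open_I convex_I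
        assms I_scaled DERIV_p1]) (auto intro!: continuous_intros)
  from DERIV_imp_deriv[OF this] show ?thesis by simp
qed

text \<open>Integration by parts, which makes the derivative of \<open>r\<^sup>2 * A r\<close> free of \<open>p2\<close>.\<close>

lemma T_eq: assumes "r \<in> I" shows "T r = 2 * A r + r * A1 r"
proof -
  let ?D = "{- (pi / 2)..pi / 2}"
  let ?f' = "\<lambda>t. ((cos t)\<^sup>2 - (sin t)\<^sup>2) * p1 (sin t * r) + r * ((cos t)\<^sup>2 * sin t * p2 (sin t * r))"
  let ?f = "\<lambda>t. sin t * cos t * p1 (sin t * r)"
  have "(?f' has_integral ?f (pi / 2) - ?f (- (pi / 2))) ?D"
  proof (rule fundamental_theorem_of_calculus)
    fix t :: real
    have "((\<lambda>t. sin t * r) has_real_derivative cos t * r) (at t)" by (auto intro!: derivative_eq_intros)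
    from DERIV_chain2[OF DERIV_p1[OF I_scaled[OF assms]] this]
    have d: "((\<lambda>t. p1 (sin t * r)) has_real_derivative p2 (sin t * r) * (cos t * r)) (at t)" .
    have "((\<lambda>t. sin t * cos t) has_real_derivative (cos t)\<^sup>2 - (sin t)\<^sup>2) (at t)"
      by (auto intro!: derivative_eq_intros simp: power2_eq_square)
    from DERIV_mult[OF this d] have "(?f has_real_derivative ?f' t) (at t)"
      by (simp add: power2_eq_square mult_ac)
    then show "(?f has_vector_derivative ?f' t) (at t within ?D)"
      by (simp add: has_real_derivative_iff_has_vector_derivative has_vector_derivative_at_within)
  qed simp
  then have F: "(?f' has_integral 0) ?D" by simp
  have hA: "((\<lambda>t. (cos t)\<^sup>2 * p1 (sin t * r)) has_integral A r) ?D"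
    unfolding A_def by (intro integrable_integral integrable_continuous_real continuous_intros continuous_p1_arc assms)
  have hA1: "((\<lambda>t. (cos t)\<^sup>2 * sin t * p2 (sin t * r)) has_integral A1 r) ?D"
    unfolding A1_def by (intro integrable_integral integrable_continuous_real continuous_intros continuous_p2_arc assms)
  have "((\<lambda>t. 2 * ((cos t)\<^sup>2 * p1 (sin t * r)) + r * ((cos t)\<^sup>2 * sin t * p2 (sin t * r)) - ?f' t)
      has_integral 2 * A r + r * A1 r - 0) ?D"
    by (intro has_integral_diff has_integral_add has_integral_mult_right hA hA1 F)
  moreover have "2 * ((cos t)\<^sup>2 * p1 (sin t * r)) + r * ((cos t)\<^sup>2 * sin t * p2 (sin t * r)) - ?f' t
      = 1 * p1 (sin t * r)" for t
  proof -
    have "2 * ((cos t)\<^sup>2 * p1 (sin t * r)) + r * ((cos t)\<^sup>2 * sin t * p2 (sin t * r)) - ?f' t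
      = ((sin t)\<^sup>2 + (cos t)\<^sup>2) * p1 (sin t * r)" by (simp only: ring_distribs)
    then show ?thesis by (simp only: sin_cos_squared_add)
  qed
  ultimately show ?thesis unfolding T_def by (simp add: integral_unique)
qed

lemma integral_period:
  assumes "continuous_on UNIV G" "\<And>q. G (q + 1) = G q"
  shows "integral {0..1} G = integral {m..m + 1} (G :: real \<Rightarrow> real)"
proof -
  have i: "G integrable_on {a..b}" for a b
    using assms(1) by (intro integrable_continuous_real) (auto intro: continuous_on_subset)
  have "integral {0..1} G = integral {0..m} G + integral {m..1} G"
    using order by (intro Henstock_Kurzweil_Integration.integral_combine[symmetric] i) auto
  also have "integral {0..m} G = integral {1..m + 1} G"
    using integral_shift_real_ivl[of 1 1 "m + 1" G] assms(2) by simp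
  also have "integral {1..m + 1} G + integral {m..1} G = integral {m..m + 1} G"
    using Henstock_Kurzweil_Integration.integral_combine[of m 1 "m + 1" G] order i by simp
  finally show ?thesis .
qed

text \<open>Clipping the integrand at 0 trades the moving domain of integration for a fixed one and
  keeps the integrand continuous.\<close>

lemma F1_eq_integral: "F1 U c = integral {0..1} (\<lambda>q. sqrt (max 0 (U q - c)))"
proof -
  have "integral {0..1} (\<lambda>q. sqrt (max 0 (U q - c)))
      = integral {0..1} (\<lambda>q. if q \<in> {q \<in> {0..1}. c \<le> U q} then sqrt (U q - c) else 0)"
    by (intro integral_cong) (auto simp: max_def)
  also have "\<dots> = integral ({q \<in> {0..1}. c \<le> U q} \<inter> {0..1}) (\<lambda>q. sqrt (U q - c))"
    by (rule Henstock_Kurzweil_Integration.integral_restrict_Int)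
  also have "{q \<in> {0..1}. c \<le> U q} \<inter> {0..1} = {q \<in> {0..1}. c \<le> U q}" by auto
  finally show ?thesis by (simp add: F1_def)
qed

lemma sqrt_in_I: assumes "c \<in> {U m<..U M}" shows "sqrt (U M - c) \<in> I" "sqrt (U M - c) \<ge> 0"
proof -
  have "sqrt (U M - c) < R" unfolding R_def using assms by (intro real_sqrt_less_mono) auto
  moreover show "sqrt (U M - c) \<ge> 0" using assms by simp
  ultimately show "sqrt (U M - c) \<in> I" using R_pos unfolding I_def greaterThanLessThan_iff by linarith
qed

lemma F1_eq_A: assumes c: "c \<in> {U m<..U M}"
  shows "F1 U c = (U M - c) * A (sqrt (U M - c))"
proof -
  define r where "r = sqrt (U M - c)"
  have r: "r \<in> I" "- r \<in> I" "r \<ge> 0" "r\<^sup>2 = U M - c"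
    using sqrt_in_I[OF c] c by (auto simp: r_def I_def)
  define G where "G q = sqrt (max 0 (U q - c))" for q
  have cG: "continuous_on B G" for B
    unfolding G_def[abs_def] by (intro continuous_intros continuous_U)
  have "F1 U c = integral {m..m + 1} G"
    unfolding F1_eq_integral G_def[abs_def, symmetric]
    by (rule integral_period[OF cG]) (simp add: G_def periodic)
  define h where "h t = M + psi (sin t * r)" for t
  define a b where "a = M + psi (- r)" and "b = M + psi r"
  have ab: "m < a" "a < m + 1" "m < b" "b < m + 1"
    using psi(1)[OF r(1)] psi(1)[OF r(2)] by (auto simp: J_def a_def b_def)
  have psi_le: "psi (- r) \<le> psi r"
  proof (rule ccontr)
    assume "\<not> psi (- r) \<le> psi r"
    then have "y (psi r) < y (psi (- r))"
      using J_closed[OF psi(1)[OF r(1)]] J_closed[OF psi(1)[OF r(2)]] by (intro y_strict_mono) auto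
    then show False using psi(2)[OF r(1)] psi(2)[OF r(2)] r(3) by simp
  qed
  then have a_le_b: "a \<le> b" by (simp add: a_def b_def)
  \<comment> \<open>Outside \<open>{a..b}\<close> the monotone coordinate \<open>y\<close> has
    modulus at least \<open>r\<close>, so \<open>U q \<le> c\<close>.\<close>
  have zero: "G q = 0" if "q \<in> {m..a} \<union> {b..m + 1}" for q
  proof -
    have q: "q - M \<in> {m - M..m + 1 - M}" using that ab by auto
    have "r\<^sup>2 \<le> (y (q - M))\<^sup>2"
    proof (cases "q \<le> a")
      case True
      then have "q - M \<le> psi (- r)" by (simp add: a_def)
      then have "y (q - M) \<le> y (psi (- r))"
        using y_strict_mono[of "q - M" "psi (- r)"] q J_closed[OF psi(1)[OF r(2)]] by (metis less_eq_real_def)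
      then have "r \<le> - y (q - M)" using psi(2)[OF r(2)] by simp
      then have "r\<^sup>2 \<le> (- y (q - M))\<^sup>2" using r(3) by (intro power_mono) auto
      then show ?thesis by simp
    next
      case False
      then have "psi r \<le> q - M" using that by (simp add: b_def)
      then have "y (psi r) \<le> y (q - M)"
        using y_strict_mono[of "psi r" "q - M"] q J_closed[OF psi(1)[OF r(1)]] by (metis less_eq_real_def)
      then show ?thesis using psi(2)[OF r(1)] r(3) by (intro power_mono) auto
    qed
    then have "U q \<le> c" using y_squared[OF q] r(4) by simp
    then show ?thesis by (simp add: G_def)
  qed
  have i: "G integrable_on {x..z}" for x z by (intro integrable_continuous_real cG)
  have "integral {m..m + 1} G = integral {m..a} G + (integral {a..b} G + integral {b..m + 1} G)"
    using ab a_le_b i by (simp add: Henstock_Kurzweil_Integration.integral_combine)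
  also have "integral {m..a} G = integral {m..a} (\<lambda>q. 0)" by (intro integral_cong zero) auto
  also have "integral {b..m + 1} G = integral {b..m + 1} (\<lambda>q. 0)" by (intro integral_cong zero) auto
  finally have F: "F1 U c = integral {a..b} G" using \<open>F1 U c = integral {m..m + 1} G\<close> by simp
  have "((\<lambda>t. (p1 (sin t * r) * (cos t * r)) *\<^sub>R G (h t)) has_integral
      integral {h (- (pi / 2))..h (pi / 2)} G) {- (pi / 2)..pi / 2}"
  proof (rule has_integral_substitution[of _ _ _ m "m + 1"])
    show "h ` {- (pi / 2)..pi / 2} \<subseteq> {m..m + 1}"
    proof (rule image_subsetI)
      fix t
      have "psi (sin t * r) \<in> J" by (rule psi(1)[OF I_scaled[OF r(1)]])
      then show "h t \<in> {m..m + 1}" by (auto simp: h_def J_def)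
    qed
    fix t :: real
    have l: "((\<lambda>t. sin t * r) has_real_derivative cos t * r) (at t)" by (auto intro!: derivative_eq_intros)
    have "(h has_real_derivative p1 (sin t * r) * (cos t * r)) (at t)"
      unfolding h_def[abs_def]
      using DERIV_add[OF DERIV_const DERIV_chain2[OF DERIV_psi'[OF I_scaled[OF r(1)]] l]] by simp
    then show "(h has_real_derivative p1 (sin t * r) * (cos t * r)) (at t within {- (pi / 2)..pi / 2})"
      by (rule has_field_derivative_at_within)
  qed (use cG a_le_b in \<open>auto simp: h_def a_def b_def\<close>)
  moreover have "(p1 (sin t * r) * (cos t * r)) *\<^sub>R G (h t) = r\<^sup>2 * ((cos t)\<^sup>2 * p1 (sin t * r))"
    if "t \<in> {- (pi / 2)..pi / 2}" for t
  proof -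
    have "U (h t) - c = r\<^sup>2 - (sin t * r)\<^sup>2"
      unfolding h_def U_psi[OF I_scaled[OF r(1)]] r(4) by simp
    also have "\<dots> = (cos t * r)\<^sup>2"
      by (simp add: cos_squared_eq power_mult_distrib algebra_simps)
    finally have "G (h t) = \<bar>cos t * r\<bar>" by (simp add: G_def)
    also have "\<dots> = cos t * r" using that r(3) by (simp add: cos_ge_zero)
    finally show ?thesis by (simp add: power2_eq_square)
  qed
  ultimately have "((\<lambda>t. r\<^sup>2 * ((cos t)\<^sup>2 * p1 (sin t * r))) has_integral integral {a..b} G) {- (pi / 2)..pi / 2}"
    by (subst has_integral_cong[symmetric]) (simp_all add: h_def a_def b_def)
  then have "integral {a..b} G = r\<^sup>2 * A r" unfolding A_def by (simp add: integral_unique flip: integral_mult_right)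
  then show ?thesis using F r(4) by (simp add: r_def)
qed

text \<open>Both branches are the derivative of \<open>F1 U\<close> under the integral sign. Above
  the minimum its integrand is singular where \<open>U q = c\<close>, and the sine substitution
  removes the singularity.\<close>

definition f1 :: "real \<Rightarrow> real" where
  "f1 c = (if c < U m then integral {0..1} (\<lambda>q. - 1 / (2 * sqrt (U q - c))) else - T (sqrt (U M - c)) / 2)"

text \<open>At \<open>c = U M\<close> the value is the limit of the last expression, since \<open>T1 0 = 0\<close>.\<close>

definition f2 :: "real \<Rightarrow> real" where
  "f2 c = (if c < U m then integral {0..1} (\<lambda>q. - 1 / (4 * ((U q - c) * sqrt (U q - c))))
     else if c = U M then T2 0 / 4 else T1 (sqrt (U M - c)) / (4 * sqrt (U M - c)))"

section \<open>Derivatives of \<open>F1\<close> up to the maximum\<close>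

lemma DERIV_sqrt_max: "c < U M \<Longrightarrow>
   ((\<lambda>c. sqrt (U M - c)) has_real_derivative - inverse (sqrt (U M - c)) / 2) (at c)"
  by (auto intro!: derivative_eq_intros)

lemma DERIV_F1: assumes c: "c \<in> {U m<..<U M}" shows "(F1 U has_real_derivative f1 c) (at c)"
proof -
  define r where "r = sqrt (U M - c)"
  have r: "r \<in> I" "r > 0" "r * r = U M - c" using sqrt_in_I[of c] c by (auto simp: r_def)
  have s: "((\<lambda>c. U M - c) has_real_derivative - 1) (at c)" by (auto intro!: derivative_eq_intros)
  from DERIV_mult[OF s DERIV_chain2[OF DERIV_A DERIV_sqrt_max]] r(1) c
  have "((\<lambda>c. (U M - c) * A (sqrt (U M - c))) has_real_derivative
      - 1 * A r + A1 r * (- inverse r / 2) * (U M - c)) (at c)" by (simp add: r_def)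
  moreover have "- 1 * A r + A1 r * (- inverse r / 2) * (U M - c) = f1 c"
    using c r(2) T_eq[OF r(1)] unfolding f1_def r_def[symmetric] r(3)[symmetric]
    by (simp add: field_simps)
  ultimately have "((\<lambda>c. (U M - c) * A (sqrt (U M - c))) has_real_derivative f1 c) (at c)" by simp
  then show ?thesis
    by (rule has_field_derivative_transform_within_open[of _ _ _ "{U m<..<U M}"])
       (use c F1_eq_A in auto)
qed

lemma DERIV_f1: assumes c: "c \<in> {U m<..<U M}" shows "(f1 has_real_derivative f2 c) (at c)"
proof -
  define r where "r = sqrt (U M - c)"
  have r: "r \<in> I" "r > 0" using sqrt_in_I[of c] c by (auto simp: r_def)
  from DERIV_cmult[OF DERIV_chain2[OF DERIV_T DERIV_sqrt_max], of c "- 1 / 2"] r(1) c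
  have "((\<lambda>c. - 1 / 2 * T (sqrt (U M - c))) has_real_derivative
      - 1 / 2 * (T1 r * (- inverse r / 2))) (at c)" by (simp add: r_def)
  moreover have "- 1 / 2 * (T1 r * (- inverse r / 2)) = f2 c"
    using c r unfolding f2_def r_def[symmetric] by (simp add: field_simps)
  ultimately have "((\<lambda>c. - 1 / 2 * T (sqrt (U M - c))) has_real_derivative f2 c) (at c)" by simp
  then show ?thesis
    by (rule has_field_derivative_transform_within_open[of _ _ _ "{U m<..<U M}"])
       (use c in \<open>auto simp: f1_def\<close>)
qed

lemma DERIV_f2: assumes c: "c \<in> {U m<..<U M}" shows "(f2 has_real_derivative deriv f2 c) (at c)"
proof -
  have r: "sqrt (U M - c) \<in> I" "4 * sqrt (U M - c) \<noteq> 0" "c < U M" using sqrt_in_I[of c] c by auto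
  note D = DERIV_divide[OF DERIV_chain2[OF DERIV_T1[OF r(1)] DERIV_sqrt_max[OF r(3)]]
     DERIV_cmult[OF DERIV_sqrt_max[OF r(3)], of 4] r(2)]
  obtain d where "(f2 has_real_derivative d) (at c)"
    using has_field_derivative_transform_within_open[OF D, of "{U m<..<U M}" f2] c by (auto simp: f2_def)
  then show ?thesis by (metis DERIV_imp_deriv)
qed

lemma T1_0: "T1 0 = 0"
proof -
  have "(sin has_integral (- cos (pi / 2)) - (- cos (- (pi / 2)))) {- (pi / 2)..pi / 2}"
    by (rule fundamental_theorem_of_calculus)
       (auto intro!: derivative_eq_intros simp: has_real_derivative_iff_has_vector_derivative[symmetric])
  then have "((\<lambda>t. sin t * p2 0) has_integral 0 * p2 0) {- (pi / 2)..pi / 2}"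
    by (intro has_integral_mult_left) simp
  from integral_unique[OF this] show ?thesis unfolding T1_eq[OF zero_I] by (simp del: integral_mult_left)
qed

lemma sqrt_left_limit: "filterlim (\<lambda>c. sqrt (U M - c)) (at 0) (at_left (U M))"
proof (rule filterlim_atI)
  have "((\<lambda>c. sqrt (U M - c)) \<longlongrightarrow> sqrt (U M - U M)) (at_left (U M))" by (intro tendsto_intros)
  then show "((\<lambda>c. sqrt (U M - c)) \<longlongrightarrow> 0) (at_left (U M))" by simp
  show "\<forall>\<^sub>F c in at_left (U M). sqrt (U M - c) \<noteq> 0"
    using eventually_at_left_real[OF U_min_less_max] by eventually_elim auto
qed

lemma eventually_left: "\<forall>\<^sub>F c in at_left (U M). c \<in> {U m<..<U M}"
  by (rule eventually_at_left_real[OF U_min_less_max])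

text \<open>As \<open>T1 0 = 0\<close>, the quotient \<open>T1 r / r\<close> is the difference
  quotient of \<open>T1\<close> at 0, with limit \<open>T2 0\<close>.\<close>

lemma f2_limit: "(f2 \<longlongrightarrow> f2 (U M)) (at_left (U M))"
proof -
  have "((\<lambda>r. (T1 r - T1 0) / (r - 0)) \<longlongrightarrow> T2 0) (at 0)"
    using DERIV_T1[OF zero_I] by (simp add: has_field_derivative_iff)
  from filterlim_compose[OF this sqrt_left_limit]
  have "((\<lambda>c. T1 (sqrt (U M - c)) / sqrt (U M - c) / 4) \<longlongrightarrow> T2 0 / 4) (at_left (U M))"
    by (intro tendsto_divide) (simp_all add: T1_0)
  moreover have "\<forall>\<^sub>F c in at_left (U M). T1 (sqrt (U M - c)) / sqrt (U M - c) / 4 = f2 c"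
    using eventually_left by eventually_elim (auto simp: f2_def)
  ultimately have "(f2 \<longlongrightarrow> T2 0 / 4) (at_left (U M))" by (rule Lim_transform_eventually)
  then show ?thesis using U_min_less_max by (simp add: f2_def)
qed

lemma f1_limit: "(f1 \<longlongrightarrow> f1 (U M)) (at_left (U M))"
proof -
  have "(T \<longlongrightarrow> T 0) (at 0)" using DERIV_T[OF zero_I] DERIV_isCont isContD by blast
  from filterlim_compose[OF this sqrt_left_limit]
  have "((\<lambda>c. - T (sqrt (U M - c)) / 2) \<longlongrightarrow> - T 0 / 2) (at_left (U M))"
    by (intro tendsto_intros) auto
  moreover have "\<forall>\<^sub>F c in at_left (U M). - T (sqrt (U M - c)) / 2 = f1 c"
    using eventually_left by eventually_elim (auto simp: f1_def)
  ultimately have "(f1 \<longlongrightarrow> - T 0 / 2) (at_left (U M))" by (rule Lim_transform_eventually)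
  then show ?thesis using U_min_less_max by (simp add: f1_def)
qed

lemma F1_limit: "(F1 U \<longlongrightarrow> F1 U (U M)) (at_left (U M))"
proof -
  have "(A \<longlongrightarrow> A 0) (at 0)" using DERIV_A[OF zero_I] DERIV_isCont isContD by blast
  from filterlim_compose[OF this sqrt_left_limit]
  have "((\<lambda>c. (U M - c) * A (sqrt (U M - c))) \<longlongrightarrow> (U M - U M) * A 0) (at_left (U M))"
    by (intro tendsto_intros)
  moreover have "\<forall>\<^sub>F c in at_left (U M). (U M - c) * A (sqrt (U M - c)) = F1 U c"
    using eventually_left by eventually_elim (auto simp: F1_eq_A)
  ultimately have "(F1 U \<longlongrightarrow> (U M - U M) * A 0) (at_left (U M))" by (rule Lim_transform_eventually)
  then show ?thesis using F1_eq_A[of "U M"] U_min_less_max by simp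
qed

lemma DERIV_upper:
  assumes "c \<in> {U m<..U M}"
  shows "(F1 U has_real_derivative f1 c) (at c within {U m<..U M})"
    and "(f1 has_real_derivative f2 c) (at c within {U m<..U M})"
  using has_real_derivative_from_left_limit[OF U_min_less_max DERIV_F1 F1_limit f1_limit]
    has_real_derivative_from_left_limit[OF U_min_less_max DERIV_f1 f1_limit f2_limit]
    has_field_derivative_at_within[OF DERIV_F1, of c] has_field_derivative_at_within[OF DERIV_f1, of c] assms
  by (cases "c = U M"; simp)+

lemma T_pos: assumes "r \<in> I" shows "T r > 0"
proof -
  have "integral {- (pi / 2)..pi / 2} (\<lambda>t. 0) < integral {- (pi / 2)..pi / 2} (\<lambda>t. 1 * p1 (sin t * r))"
  proof (rule integral_less_real)
    show "{- (pi / 2)<..<pi / 2} \<noteq> {}" using pi_gt_zero by (simp add: not_le)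
    show "continuous_on {- (pi / 2)..pi / 2} (\<lambda>t. 1 * p1 (sin t * r))"
      by (intro continuous_intros continuous_p1_arc assms)
  qed (use p1_pos I_scaled assms in auto)
  then show ?thesis by (simp add: T_def)
qed

lemma f1_neg: "c \<in> {U m<..U M} \<Longrightarrow> f1 c < 0"
  using T_pos[OF sqrt_in_I(1)] by (simp add: f1_def)

end

subsection \<open>Behaviour near and below the minimum\<close>

context profile
begin

section \<open>Divergence when the level descends to the minimum\<close>

lemma periodic_derivatives: "U1 (q + 1) = U1 q" "U2 (q + 1) = U2 q"
proof -
  have "U1 (q + 1) = U1 q" for q
  proof -
    have "((\<lambda>x. U (x + 1)) has_real_derivative U1 (q + 1)) (at q)"
      using DERIV_shift[of U "U1 (q + 1)" q 1] dU by simp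
    then show ?thesis using DERIV_unique[OF _ dU] by (simp add: periodic)
  qed
  note U1 = this
  show "U1 (q + 1) = U1 q" by (rule U1)
  have "((\<lambda>x. U1 (x + 1)) has_real_derivative U2 (q + 1)) (at q)"
    using DERIV_shift[of U1 "U2 (q + 1)" q 1] dU1 by simp
  then show "U2 (q + 1) = U2 q" using DERIV_unique[OF _ dU1] by (simp add: U1)
qed

lemma continuous_U2: "continuous_on B U2"
  using Cdiff_imp_continuous_on[OF smooth] by (rule continuous_on_subset) simp

lemma continuous_U1: "continuous_on B U1"
  by (meson DERIV_imp_continuous_on dU1)

text \<open>The Taylor upper bound for \<open>U (q + h)\<close>, taken at its minimizer \<open>h = - U1 q / C\<close>.\<close>

lemma derivative_bound:
  obtains C where "C > 0" "\<And>q. q \<in> {m..m + 1} \<Longrightarrow> (U1 q)\<^sup>2 \<le> 2 * C * (U q - U m)"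
proof -
  let ?K = "{m - 1..m + 2}"
  have "bounded (U1 ` ?K)" "bounded (U2 ` ?K)"
    by (intro compact_imp_bounded compact_continuous_image continuous_U1 continuous_U2 compact_Icc)+
  then have "\<exists>C1. \<forall>q\<in>?K. \<bar>U1 q\<bar> \<le> C1" "\<exists>C2. \<forall>q\<in>?K. \<bar>U2 q\<bar> \<le> C2"
    unfolding bounded_iff by auto
  then obtain C1 C2 where C12: "\<And>q. q \<in> ?K \<Longrightarrow> \<bar>U1 q\<bar> \<le> C1" "\<And>q. q \<in> ?K \<Longrightarrow> \<bar>U2 q\<bar> \<le> C2"
    by blast
  \<comment> \<open>\<open>C\<close> dominates \<open>U2\<close> for the Taylor bound, and
    \<open>U1\<close> so that \<open>\<bar>h\<bar> \<le> 1\<close> keeps \<open>q + h\<close> in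
    \<open>?K\<close>.\<close>
  define C where "C = 1 + \<bar>C1\<bar> + \<bar>C2\<bar>"
  have C: "C > 0" "\<And>q. q \<in> ?K \<Longrightarrow> \<bar>U1 q\<bar> \<le> C" "\<And>q. q \<in> ?K \<Longrightarrow> \<bar>U2 q\<bar> \<le> C"
    unfolding C_def using C12 by (auto intro: order_trans[OF C12(1)] order_trans[OF C12(2)])
  have "(U1 q)\<^sup>2 \<le> 2 * C * (U q - U m)" if q: "q \<in> {m..m + 1}" for q
  proof -
    define h where "h = - U1 q / C"
    have "\<bar>h\<bar> \<le> 1" unfolding h_def using C(1) C(2)[of q] q by (simp add: abs_divide)
    then have qh: "q \<in> ?K" "q + h \<in> ?K" using q by auto
    \<comment> \<open>The tangent inequality at \<open>q\<close> for the convex function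
      \<open>C * z^2 / 2 - U z\<close>.\<close>
    have "(C * q - U1 q) * ((q + h) - q) \<le> (C * (q + h)\<^sup>2 / 2 - U (q + h)) - (C * q\<^sup>2 / 2 - U q)"
    proof (rule f''_imp_f'[where C = ?K and f'' = "\<lambda>z. C - U2 z"])
      fix z assume z: "z \<in> ?K"
      show "((\<lambda>z. C * z\<^sup>2 / 2 - U z) has_real_derivative C * z - U1 z) (at z)"
        by (auto intro!: derivative_eq_intros dU)
      show "((\<lambda>z. C * z - U1 z) has_real_derivative C - U2 z) (at z)"
        by (auto intro!: derivative_eq_intros dU1)
      show "0 \<le> C - U2 z" using C(3)[OF z] by auto
    qed (use qh in auto)
    then have "U (q + h) \<le> U q + (U1 q * h + C * h\<^sup>2 / 2)" by (simp add: algebra_simps power2_eq_square add_divide_distrib)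
    also have "U1 q * h + C * h\<^sup>2 / 2 = - (U1 q)\<^sup>2 / (2 * C)"
      using C(1) by (simp add: h_def power2_eq_square field_simps)
    finally have "U m \<le> U q - (U1 q)\<^sup>2 / (2 * C)" using U_bounds(1)[of "q + h"] by (simp add: add.assoc)
    then show ?thesis using C(1) by (simp add: field_simps)
  qed
  with C(1) show ?thesis by (rule that)
qed

text \<open>\<open>derivative_bound\<close> at \<open>q = M + psi z\<close>, multiplied by
  \<open>(p1 z)^2\<close>: there \<open>U1 * p1 z = - 2 * z\<close> and
  \<open>U - U m = R^2 - z^2\<close>. Thus \<open>p1\<close> grows at least like
  \<open>1 / sqrt (R^2 - z^2)\<close> at the ends of \<open>I\<close>.\<close>

lemma p1_lower_bound:
  obtains C where "C > 0" "\<And>z. z \<in> I \<Longrightarrow> 4 * z\<^sup>2 \<le> C * (R\<^sup>2 - z\<^sup>2) * (p1 z)\<^sup>2"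
proof -
  obtain C where C: "C > 0" "\<And>q. q \<in> {m..m + 1} \<Longrightarrow> (U1 q)\<^sup>2 \<le> 2 * C * (U q - U m)"
    by (rule derivative_bound) blast
  have "4 * z\<^sup>2 \<le> 2 * C * (R\<^sup>2 - z\<^sup>2) * (p1 z)\<^sup>2" if z: "z \<in> I" for z
  proof -
    have "M + psi z \<in> {m..m + 1}" using psi(1)[OF z] by (auto simp: J_def)
    from C(2)[OF this] have "(U1 (M + psi z))\<^sup>2 \<le> 2 * C * (R\<^sup>2 - z\<^sup>2)"
      by (simp add: U_psi[OF z] R_squared algebra_simps)
    then have "(U1 (M + psi z))\<^sup>2 * (p1 z)\<^sup>2 \<le> 2 * C * (R\<^sup>2 - z\<^sup>2) * (p1 z)\<^sup>2"
      by (rule mult_right_mono) simp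
    moreover have "(U1 (M + psi z))\<^sup>2 * (p1 z)\<^sup>2 = (- 2 * z)\<^sup>2"
      unfolding U1_psi[OF z, symmetric] by (rule power_mult_distrib[symmetric])
    ultimately show ?thesis by (simp add: power_mult_distrib)
  qed
  with C(1) show ?thesis by (intro that[of "2 * C"]) auto
qed

text \<open>Near the ends of \<open>I\<close> the cubic term of \<open>p2_eq\<close> beats any
  multiple of \<open>p1\<close>; on the remaining compact part \<open>B\<close> absorbs a continuous
  function.\<close>

lemma p2_lower_bound:
  obtains B where "B \<ge> 0" "\<And>z. z \<in> I \<Longrightarrow> K * p1 z - B \<le> z * p2 z"
proof -
  define \<alpha> where "\<alpha> = U2 m / 2"
  have \<alpha>: "\<alpha> > 0" using U2_min by (simp add: \<alpha>_def)
  have "isCont U2 m" using continuous_U2[of UNIV] by (simp add: continuous_on_eq_continuous_at)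
  then obtain d where d: "d > 0" "\<And>q. \<bar>q - m\<bar> < d \<Longrightarrow> \<bar>U2 q - U2 m\<bar> < \<alpha>"
    using \<alpha> unfolding continuous_at_eps_delta dist_real_def by (metis dist_real_def)
  have U2: "U2 q \<ge> \<alpha>" if "\<bar>q - m\<bar> < d \<or> \<bar>q - (m + 1)\<bar> < d" for q
  proof -
    have "\<bar>U2 q - U2 m\<bar> < \<alpha>"
      using that d(2)[of q] d(2)[of "q - 1"] periodic_derivatives(2)[of "q - 1"] by (auto simp: algebra_simps)
    then show ?thesis unfolding \<alpha>_def by linarith
  qed
  obtain e0 where "0 < e0" "e0 < M - m" "e0 < m + 1 - M"
    using field_lbound_gt_zero[of "M - m" "m + 1 - M"] order by auto
  then obtain e where e: "0 < e" "e < d" "e < M - m" "e < m + 1 - M"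
    using field_lbound_gt_zero[OF d(1)] by (metis order.strict_trans)
  have eJ: "m - M + e \<in> J" "m + 1 - M - e \<in> J" using e by (auto simp: J_def)
  obtain C where C: "C > 0" "\<And>z. z \<in> I \<Longrightarrow> 4 * z\<^sup>2 \<le> C * (R\<^sup>2 - z\<^sup>2) * (p1 z)\<^sup>2"
    by (rule p1_lower_bound) blast
  \<comment> \<open>With this value, \<open>L \<le> C * (p1 z)^2\<close> says that
    \<open>2 * \<bar>K\<bar> \<le> \<alpha> * (p1 z)^2\<close>.\<close>
  define L where "L = C * (2 * \<bar>K\<bar> / \<alpha>)"
  have L: "L \<ge> 0" using C(1) \<alpha> by (simp add: L_def)
  \<comment> \<open>Beyond the first two numbers \<open>M + psi z\<close> is within \<open>e\<close>
    of an end of the period, so \<open>U2\<close> is at least \<open>\<alpha>\<close> there; beyond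
    the third, \<open>L * (R^2 - z^2) \<le> 4 * z^2\<close>, which makes \<open>p1 z\<close>
    large.\<close>
  define \<rho> where "\<rho> = Max {\<bar>y (m - M + e)\<bar>, \<bar>y (m + 1 - M - e)\<bar>, R * sqrt (L / (4 + L))}"
  have "L / (4 + L) < 1" using L by simp
  then have "sqrt (L / (4 + L)) < 1" using real_sqrt_less_mono by fastforce
  then have "R * sqrt (L / (4 + L)) < R * 1" using R_pos by (intro mult_strict_left_mono)
  then have \<rho>: "\<rho> < R" unfolding \<rho>_def using y_in_I[OF eJ(1)] y_in_I[OF eJ(2)] by (auto simp: I_def)
  have outer: "K * p1 z \<le> z * p2 z" if z: "z \<in> I" "\<rho> < \<bar>z\<bar>" for z
  proof -
    have big: "\<bar>y (m - M + e)\<bar> < \<bar>z\<bar>" "\<bar>y (m + 1 - M - e)\<bar> < \<bar>z\<bar>" "R * sqrt (L / (4 + L)) < \<bar>z\<bar>"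
      using z(2) by (auto simp: \<rho>_def)
    have "psi z < m - M + e \<or> psi z > m + 1 - M - e"
    proof (rule ccontr)
      assume "\<not> ?thesis"
      then have "y (m - M + e) \<le> y (psi z)" "y (psi z) \<le> y (m + 1 - M - e)"
        using y_strict_mono[of "m - M + e" "psi z"] y_strict_mono[of "psi z" "m + 1 - M - e"]
          J_closed[OF eJ(1)] J_closed[OF eJ(2)] J_closed[OF psi(1)[OF z(1)]]
        by (metis less_eq_real_def not_less)+
      then show False using big(1,2) psi(2)[OF z(1)] by auto
    qed
    then have "\<alpha> \<le> U2 (M + psi z)" using psi(1)[OF z(1)] e(1,2) by (intro U2) (auto simp: J_def)
    then have a: "\<alpha> * (p1 z)^3 \<le> U2 (M + psi z) * (p1 z)^3"
      using p1_pos[OF z(1)] by (intro mult_right_mono) auto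
    have "R\<^sup>2 * (L / (4 + L)) = (R * sqrt (L / (4 + L)))\<^sup>2" using L by (simp add: power_mult_distrib)
    also have "\<dots> \<le> \<bar>z\<bar>\<^sup>2" using big(3) L R_pos by (intro power_mono) auto
    finally have "R\<^sup>2 * L \<le> z\<^sup>2 * (4 + L)" using L by (simp add: field_simps)
    then have "L * (R\<^sup>2 - z\<^sup>2) \<le> 4 * z\<^sup>2" by (simp add: algebra_simps)
    also have "\<dots> \<le> C * (p1 z)\<^sup>2 * (R\<^sup>2 - z\<^sup>2)" using C(2)[OF z(1)] by (simp add: mult_ac)
    finally have "L \<le> C * (p1 z)\<^sup>2"
    proof (rule mult_right_le_imp_le)
      have "\<bar>z\<bar>\<^sup>2 < R\<^sup>2" using z(1) by (intro power_strict_mono) (auto simp: I_def)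
      then show "0 < R\<^sup>2 - z\<^sup>2" by simp
    qed
    then have "2 * \<bar>K\<bar> \<le> \<alpha> * (p1 z)\<^sup>2" using C(1) \<alpha> by (simp add: L_def field_simps)
    then have "2 * \<bar>K\<bar> * p1 z \<le> \<alpha> * (p1 z)\<^sup>2 * p1 z"
      using p1_pos[OF z(1)] by (intro mult_right_mono) auto
    also have "\<dots> = \<alpha> * (p1 z)^3" by (simp add: power3_eq_cube power2_eq_square)
    finally have "2 * \<bar>K\<bar> * p1 z \<le> (p1 z)^3 * U2 (M + psi z)" using a by (simp add: mult.commute)
    moreover have "K * p1 z \<le> \<bar>K\<bar> * p1 z" using p1_pos[OF z(1)] by (intro mult_right_mono) auto
    ultimately show ?thesis using p2_eq[OF z(1)] p1_pos[OF z(1)] by linarith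
  qed
  have "continuous_on I (\<lambda>z. z * p2 z - K * p1 z)"
    by (intro continuous_intros Cdiff_imp_continuous_on[OF Cdiff_p1] Cdiff_imp_continuous_on[OF Cdiff_p2])
  then have "continuous_on {- \<rho>..\<rho>} (\<lambda>z. z * p2 z - K * p1 z)"
    by (rule continuous_on_subset) (use \<rho> in \<open>auto simp: I_def\<close>)
  then have "bounded ((\<lambda>z. z * p2 z - K * p1 z) ` {- \<rho>..\<rho>})"
    by (intro compact_imp_bounded compact_continuous_image compact_Icc)
  then have "\<exists>B. \<forall>z\<in>{- \<rho>..\<rho>}. \<bar>z * p2 z - K * p1 z\<bar> \<le> B"
    unfolding bounded_iff by auto
  then obtain B where B: "\<And>z. z \<in> {- \<rho>..\<rho>} \<Longrightarrow> \<bar>z * p2 z - K * p1 z\<bar> \<le> B"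
    by blast
  show ?thesis
  proof (rule that[of "\<bar>B\<bar>"])
    fix z assume z: "z \<in> I"
    show "K * p1 z - \<bar>B\<bar> \<le> z * p2 z"
    proof (cases "\<rho> < \<bar>z\<bar>")
      case True then show ?thesis using outer[OF z] by linarith
    next
      case False
      then have "\<bar>z * p2 z - K * p1 z\<bar> \<le> B" by (intro B) auto
      then show ?thesis by linarith
    qed
  qed simp
qed

text \<open>\<open>p2_lower_bound\<close> integrated along \<open>z = r * sin t\<close>, where
  \<open>z * p2 z\<close> is \<open>r\<close> times the integrand of \<open>T1 r\<close>.\<close>

lemma T1_lower_bound:
  obtains B where "B \<ge> 0" "\<And>r. r \<in> I \<Longrightarrow> K * T r - B \<le> r * T1 r"
proof -
  obtain B where B: "B \<ge> 0" "\<And>z. z \<in> I \<Longrightarrow> K * p1 z - B \<le> z * p2 z" by (rule p2_lower_bound[of K]) blast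
  have "K * T r - B * pi \<le> r * T1 r" if r: "r \<in> I" for r
  proof -
    let ?D = "{- (pi / 2)..pi / 2}"
    have "((\<lambda>t. K * (1 * p1 (sin t * r)) - B) has_integral K * T r - measure lborel ?D *\<^sub>R B) ?D"
      unfolding T_def
      by (intro has_integral_diff has_integral_mult_right has_integral_const_real integrable_integral
          integrable_continuous_real continuous_intros continuous_p1_arc r)
    moreover have "((\<lambda>t. r * (sin t * p2 (sin t * r))) has_integral r * T1 r) ?D"
      unfolding T1_eq[OF r]
      by (intro has_integral_mult_right integrable_integral
          integrable_continuous_real continuous_intros continuous_p2_arc r)
    moreover have "K * (1 * p1 (sin t * r)) - B \<le> r * (sin t * p2 (sin t * r))" for t
      using B(2)[OF I_scaled[OF r]] by (simp add: mult_ac)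
    ultimately have "K * T r - measure lborel ?D *\<^sub>R B \<le> r * T1 r" by (rule has_integral_le)
    then show ?thesis by (simp add: mult.commute)
  qed
  then show ?thesis using B(1) by (intro that[of "B * pi"]) auto
qed

text \<open>The logarithmic divergence of \<open>T\<close> as \<open>r\<close> approaches
  \<open>R\<close>: along the arc the lower bound for \<open>p1\<close> becomes a multiple of
  \<open>r * sin t / (\<eta> + r * cos t)\<close>, a logarithmic derivative up to sign.\<close>

lemma T_lower_bound:
  obtains k where "k > 0" "\<And>r. 0 < r \<Longrightarrow> r < R \<Longrightarrow> k * (ln r - ln (sqrt (R\<^sup>2 - r\<^sup>2))) \<le> T r"
proof -
  obtain C where C: "C > 0" "\<And>z. z \<in> I \<Longrightarrow> 4 * z\<^sup>2 \<le> C * (R\<^sup>2 - z\<^sup>2) * (p1 z)\<^sup>2"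
    by (rule p1_lower_bound) blast
  define k where "k = 2 / sqrt C"
  have k: "k > 0" using C(1) by (simp add: k_def)
  have "k * (ln r - ln (sqrt (R\<^sup>2 - r\<^sup>2))) \<le> T r" if r: "0 < r" "r < R" for r
  proof -
    have rI: "r \<in> I" using r by (auto simp: I_def)
    define \<eta> where "\<eta> = sqrt (R\<^sup>2 - r\<^sup>2)"
    have "r\<^sup>2 < R\<^sup>2" using r by (intro power_strict_mono) auto
    then have \<eta>: "\<eta> > 0" "\<eta>\<^sup>2 = R\<^sup>2 - r\<^sup>2" by (auto simp: \<eta>_def)
    have pos: "\<eta> + r * cos t > 0" if "t \<in> {0..pi / 2}" for t
      using that \<eta> r by (intro add_pos_nonneg mult_nonneg_nonneg cos_ge_zero) auto
    have "((\<lambda>t. k * (r * sin t / (\<eta> + r * cos t))) has_integral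
        - k * ln (\<eta> + r * cos (pi / 2)) - - k * ln (\<eta> + r * cos 0)) {0..pi / 2}"
    proof (rule fundamental_theorem_of_calculus)
      fix t assume t: "t \<in> {0..pi / 2}"
      have "((\<lambda>t. - k * ln (\<eta> + r * cos t)) has_real_derivative k * (r * sin t / (\<eta> + r * cos t))) (at t)"
        using pos[OF t] by (auto intro!: derivative_eq_intros simp: field_simps)
      then show "((\<lambda>t. - k * ln (\<eta> + r * cos t)) has_vector_derivative k * (r * sin t / (\<eta> + r * cos t)))
          (at t within {0..pi / 2})"
        by (simp add: has_real_derivative_iff_has_vector_derivative has_vector_derivative_at_within)
    qed simp
    moreover have "((\<lambda>t. p1 (sin t * r)) has_integral integral {0..pi / 2} (\<lambda>t. p1 (sin t * r))) {0..pi / 2}"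
      by (intro integrable_integral integrable_continuous_real continuous_p1_arc rI)
    moreover have "k * (r * sin t / (\<eta> + r * cos t)) \<le> p1 (sin t * r)" if t: "t \<in> {0..pi / 2}" for t
    proof -
      define z where "z = sin t * r"
      have z: "z \<in> I" "z \<ge> 0" using I_scaled[OF rI] sin_ge_zero[of t] t r by (auto simp: z_def)
      have c: "r * cos t \<ge> 0" using t r by (intro mult_nonneg_nonneg cos_ge_zero) auto
      \<comment> \<open>The sum of squares is replaced by the larger square of the sum in order to
        obtain an integrand with an elementary primitive.\<close>
      have "R\<^sup>2 - z\<^sup>2 = \<eta>\<^sup>2 + (r * cos t)\<^sup>2"
        unfolding \<eta>(2) z_def by (simp add: cos_squared_eq power_mult_distrib algebra_simps)
      also have "\<dots> \<le> (\<eta> + r * cos t)\<^sup>2" using \<eta>(1) c by (simp add: power2_sum)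
      finally have "C * (R\<^sup>2 - z\<^sup>2) * (p1 z)\<^sup>2 \<le> C * (\<eta> + r * cos t)\<^sup>2 * (p1 z)\<^sup>2"
        using C(1) by (intro mult_right_mono mult_left_mono) auto
      from order_trans[OF C(2)[OF z(1)] this]
      have "(2 * z)\<^sup>2 \<le> (sqrt C * (\<eta> + r * cos t) * p1 z)\<^sup>2"
        using C(1) by (simp add: power_mult_distrib)
      then have "2 * z \<le> sqrt C * (\<eta> + r * cos t) * p1 z"
      proof (rule power2_le_imp_le)
        show "0 \<le> sqrt C * (\<eta> + r * cos t) * p1 z"
          using C(1) pos[OF t] p1_pos[OF z(1)] by simp
      qed
      then have "2 * z / (sqrt C * (\<eta> + r * cos t)) \<le> p1 z"
        using C(1) pos[OF t] by (simp add: divide_le_eq mult_ac)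
      then show ?thesis by (simp add: k_def z_def mult_ac)
    qed
    ultimately have "- k * ln (\<eta> + r * cos (pi / 2)) - - k * ln (\<eta> + r * cos 0)
        \<le> integral {0..pi / 2} (\<lambda>t. p1 (sin t * r))" by (rule has_integral_le)
    \<comment> \<open>Since \<open>p1\<close> is positive, half of the arc already bounds the whole
      integral from below.\<close>
    also have "\<dots> \<le> integral {- (pi / 2)..pi / 2} (\<lambda>t. p1 (sin t * r))"
      using p1_pos[OF I_scaled[OF rI]]
      by (intro integral_subset_le integrable_continuous_real continuous_p1_arc rI) (auto intro: less_imp_le)
    also have "\<dots> = T r" by (simp add: T_def)
    finally have "k * (ln (\<eta> + r) - ln \<eta>) \<le> T r" by (simp add: algebra_simps)
    moreover have "k * (ln r - ln \<eta>) \<le> k * (ln (\<eta> + r) - ln \<eta>)"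
      using k r \<eta> by (intro mult_left_mono) auto
    ultimately show ?thesis unfolding \<eta>_def by linarith
  qed
  with k show ?thesis by (rule that)
qed

lemma T_at_top: "filterlim (\<lambda>c. T (sqrt (U M - c))) at_top (at_right (U m))"
proof -
  obtain k where k: "k > 0" "\<And>r. 0 < r \<Longrightarrow> r < R \<Longrightarrow> k * (ln r - ln (sqrt (R\<^sup>2 - r\<^sup>2))) \<le> T r"
    by (rule T_lower_bound) blast
  have ev: "\<forall>\<^sub>F c in at_right (U m). c \<in> {U m<..<U M}"
    by (rule eventually_at_right_real[OF U_min_less_max])
  have "filterlim (\<lambda>c. sqrt (c - U m)) (at_right 0) (at_right (U m))"
    unfolding filterlim_at
  proof
    have "((\<lambda>c. sqrt (c - U m)) \<longlongrightarrow> sqrt (U m - U m)) (at_right (U m))" by (intro tendsto_intros)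
    then show "((\<lambda>c. sqrt (c - U m)) \<longlongrightarrow> 0) (at_right (U m))" by simp
    show "\<forall>\<^sub>F c in at_right (U m). sqrt (c - U m) \<in> {0<..} \<and> sqrt (c - U m) \<noteq> 0"
      using ev by eventually_elim auto
  qed
  from filterlim_compose[OF ln_at_0 this]
  have "filterlim (\<lambda>c. - ln (sqrt (c - U m))) at_top (at_right (U m))"
    by (simp add: filterlim_uminus_at_top)
  moreover have "((\<lambda>c. ln (sqrt (U M - c))) \<longlongrightarrow> ln (sqrt (U M - U m))) (at_right (U m))"
    using U_min_less_max by (intro tendsto_intros) auto
  ultimately have "filterlim (\<lambda>c. ln (sqrt (U M - c)) + - ln (sqrt (c - U m))) at_top (at_right (U m))"
    by (intro filterlim_tendsto_add_at_top)
  then have "filterlim (\<lambda>c. k * (ln (sqrt (U M - c)) + - ln (sqrt (c - U m)))) at_top (at_right (U m))"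
    using k(1) by (intro filterlim_tendsto_pos_mult_at_top[OF tendsto_const])
  then show ?thesis
  proof (rule filterlim_at_top_mono)
    show "\<forall>\<^sub>F c in at_right (U m). k * (ln (sqrt (U M - c)) + - ln (sqrt (c - U m))) \<le> T (sqrt (U M - c))"
      using ev
    proof eventually_elim
      case (elim c)
      then have "sqrt (U M - c) < R" unfolding R_def by (intro real_sqrt_less_mono) auto
      moreover have "R\<^sup>2 - (sqrt (U M - c))\<^sup>2 = c - U m" using elim by (simp add: R_squared)
      note k(2)[of "sqrt (U M - c)", unfolded this]
      ultimately show ?case using elim by simp
    qed
  qed
qed

lemma f2_blowup: "\<forall>\<^sub>F c in at_right (U m). K * (- f1 c) < f2 c"
proof -
  \<comment> \<open>The claim amounts to \<open>2 * r^2 * K * T r < r * T1 r\<close>. The first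
    summand covers the left side, as \<open>r \<le> R\<close>; the extra 1 leaves one
    \<open>T r\<close> to absorb \<open>B\<close>.\<close>
  define L where "L = 2 * R\<^sup>2 * \<bar>K\<bar> + 1"
  obtain B where B: "B \<ge> 0" "\<And>r. r \<in> I \<Longrightarrow> L * T r - B \<le> r * T1 r" by (rule T1_lower_bound) blast
  have "\<forall>\<^sub>F c in at_right (U m). B < T (sqrt (U M - c))"
    using T_at_top by (simp add: filterlim_at_top_dense)
  then show ?thesis using eventually_at_right_real[OF U_min_less_max]
  proof eventually_elim
    case (elim c)
    define r where "r = sqrt (U M - c)"
    have r: "r \<in> I" "r > 0" using sqrt_in_I[of c] elim(2) by (auto simp: r_def)
    have "r\<^sup>2 \<le> R\<^sup>2" using r by (intro power_mono) (auto simp: I_def)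
    have T: "T r > B" "T r > 0" using elim(1) T_pos[OF r(1)] by (auto simp: r_def)
    have "K * T r \<le> \<bar>K\<bar> * T r" using T(2) by (intro mult_right_mono) auto
    then have "2 * r\<^sup>2 * (K * T r) \<le> 2 * r\<^sup>2 * (\<bar>K\<bar> * T r)" by (rule mult_left_mono) simp
    also have "\<dots> \<le> 2 * R\<^sup>2 * (\<bar>K\<bar> * T r)"
      using T(2) \<open>r\<^sup>2 \<le> R\<^sup>2\<close> by (intro mult_right_mono) auto
    also have "\<dots> < L * T r - B" using T(1) by (simp add: L_def algebra_simps)
    also have "\<dots> \<le> r * T1 r" by (rule B(2)[OF r(1)])
    finally have "K * (T r / 2) < T1 r / (4 * r)"
      using r(2) by (simp add: field_simps power2_eq_square)
    then show ?case using elim(2) by (simp add: f1_def f2_def r_def)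
  qed
qed

section \<open>Levels below the minimum\<close>

lemma lower_aux: "c < U m \<Longrightarrow> U q - c > 0"
  using U_bounds(1)[of q] by simp

lemma continuous_kernel:
  "continuous_on ({..<U m} \<times> cbox 0 1) (\<lambda>(c, q). U q - c)"
  unfolding split_beta by (intro continuous_intros continuous_on_compose2[OF continuous_U[of UNIV]]) auto

lemma at_within_lower: "c < U m \<Longrightarrow> at c within {..<U m} = at c"
  by (rule at_within_open) auto

text \<open>Negative levels are included: a point of \<open>{0..<c2 + b}\<close> is moved back by
  \<open>b\<close> and may leave the nonnegative half-line.\<close>

lemma DERIV_F1_lower: assumes "c < U m" shows "(F1 U has_real_derivative f1 c) (at c)"
proof -
  have "((\<lambda>c. integral (cbox 0 1) (\<lambda>q. sqrt (U q - c))) has_field_derivative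
      integral (cbox 0 1) (\<lambda>q. - 1 / (2 * sqrt (U q - c)))) (at c within {..<U m})"
  proof (rule leibniz_rule_field_derivative)
    show "((\<lambda>c. sqrt (U q - c)) has_field_derivative - 1 / (2 * sqrt (U q - x))) (at x within {..<U m})"
      if "x \<in> {..<U m}" for x q
      using lower_aux[of x q] that by (auto intro!: derivative_eq_intros simp: field_simps)
    show "(\<lambda>q. sqrt (U q - x)) integrable_on cbox 0 1" for x
      unfolding box_real by (intro integrable_continuous_real continuous_intros continuous_U)
    show "continuous_on ({..<U m} \<times> cbox 0 1) (\<lambda>(c, q). - 1 / (2 * sqrt (U q - c)))"
      unfolding split_beta using lower_aux
      by (intro continuous_intros continuous_kernel[unfolded split_beta]) (auto simp: less_imp_neq)
  qed (use assms in auto)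
  then have "((\<lambda>c. integral {0..1} (\<lambda>q. sqrt (U q - c))) has_real_derivative f1 c) (at c)"
    using assms unfolding at_within_lower[OF assms] by (simp add: f1_def)
  then show ?thesis
  proof (rule has_field_derivative_transform_within_open[of _ _ _ "{..<U m}"])
    fix x assume "x \<in> {..<U m}"
    then show "integral {0..1} (\<lambda>q. sqrt (U q - x)) = F1 U x"
      unfolding F1_eq_integral using lower_aux[of x] by (intro integral_cong) (simp add: max_def less_imp_le)
  qed (use assms in auto)
qed

lemma DERIV_f1_lower: assumes "c < U m" shows "(f1 has_real_derivative f2 c) (at c)"
proof -
  have "((\<lambda>c. integral (cbox 0 1) (\<lambda>q. - 1 / (2 * sqrt (U q - c)))) has_field_derivative
      integral (cbox 0 1) (\<lambda>q. - 1 / (4 * ((U q - c) * sqrt (U q - c))))) (at c within {..<U m})"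
  proof (rule leibniz_rule_field_derivative)
    fix x q assume "x \<in> {..<U m}"
    then have p: "U q - x > 0" using lower_aux by simp
    then have "((\<lambda>c. - 1 / (2 * sqrt (U q - c))) has_field_derivative
       - 1 / (4 * ((sqrt (U q - x))\<^sup>2 * sqrt (U q - x)))) (at x)"
      by (auto intro!: derivative_eq_intros simp: field_simps power2_eq_square)
    from has_field_derivative_at_within[OF this, of "{..<U m}"]
    show "((\<lambda>c. - 1 / (2 * sqrt (U q - c))) has_field_derivative
       - 1 / (4 * ((U q - x) * sqrt (U q - x)))) (at x within {..<U m})"
      using p by simp
  next
    fix x assume x: "x \<in> {..<U m}"
    show "(\<lambda>q. - 1 / (2 * sqrt (U q - x))) integrable_on cbox 0 1"
      unfolding box_real using lower_aux[of x] x
      by (intro integrable_continuous_real continuous_intros continuous_U) (auto simp: less_imp_neq)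
  next
    show "continuous_on ({..<U m} \<times> cbox 0 1) (\<lambda>(c, q). - 1 / (4 * ((U q - c) * sqrt (U q - c))))"
      unfolding split_beta using lower_aux
      by (intro continuous_intros continuous_kernel[unfolded split_beta]) (auto simp: less_imp_neq)
  qed (use assms in auto)
  then have "((\<lambda>c. integral {0..1} (\<lambda>q. - 1 / (2 * sqrt (U q - c)))) has_real_derivative f2 c) (at c)"
    using assms unfolding at_within_lower[OF assms] by (simp add: f2_def)
  then show ?thesis
    by (rule has_field_derivative_transform_within_open[of _ _ _ "{..<U m}"])
       (use assms in \<open>auto simp: f1_def\<close>)
qed

lemma integral_neg:
  fixes G :: "real \<Rightarrow> real"
  assumes "continuous_on {0..1} G" "\<And>q. G q < 0"
  shows "integral {0..1} G < 0"
  using integral_less_real[of 0 1 G "\<lambda>_. 0"] assms by simp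

lemma lower_negative: assumes "c < U m" shows "f1 c < 0" "f2 c < 0"
proof -
  have p: "U q - c > 0" for q using lower_aux[OF assms] .
  have nz: "sqrt (U q - c) \<noteq> 0" for q using p[of q] by simp
  have "integral {0..1} (\<lambda>q. - 1 / (2 * sqrt (U q - c))) < 0"
    using nz p by (intro integral_neg continuous_intros continuous_U) (auto simp: divide_neg_pos)
  then show "f1 c < 0" using assms by (simp add: f1_def)
  have "integral {0..1} (\<lambda>q. - 1 / (4 * ((U q - c) * sqrt (U q - c)))) < 0"
    using nz p by (intro integral_neg continuous_intros continuous_U) (auto simp: divide_neg_pos less_imp_neq)
  then show "f2 c < 0" using assms by (simp add: f2_def)
qed

lemma F1_min_pos: "F1 U (U m) > 0"
proof -
  let ?G = "\<lambda>q. sqrt (max 0 (U q - U m))"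
  have c: "continuous_on {0..1} ?G" by (intro continuous_intros continuous_U)
  have "integral {0..1} ?G \<ge> 0" by (rule integral_nonneg) (auto intro!: integrable_continuous_real c)
  moreover have "integral {0..1} ?G \<noteq> 0"
  proof
    assume "integral {0..1} ?G = 0"
    then have z: "\<And>q. q \<in> {0..1} \<Longrightarrow> ?G q = 0" using integral_eq_0_iff[OF c] by simp
    \<comment> \<open>A point strictly between \<open>m\<close> and \<open>M\<close> that stays in
      \<open>{0..1}\<close> even when \<open>M\<close> exceeds 1.\<close>
    define q where "q = (m + min 1 M) / 2"
    have "q \<in> {0..1}" "q \<in> {m<..<m + 1}" using order by (auto simp: q_def)
    then show False using z[of q] U_min_period[of q] by simp
  qed
  ultimately show ?thesis unfolding F1_eq_integral by simp
qed

end

subsection \<open>Density of nondegenerate metrics\<close>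

context profile
begin

proposition regular_F1: "regular_F1 U f1 f2 (deriv f2) (U M) (U m) m M"
proof
  show "0 < U m" by (rule pos)
  show "U m < U M" by (rule U_min_less_max)
  show "U m \<le> U q" "U q \<le> U M" for q by (rule U_bounds)+
  show "continuous (at (U M) within {U m<..U M}) f2"
  proof -
    have "at (U M) within {U m<..U M} = at_left (U M)"
      by (rule at_within_nhd[of _ "{U m<..}"]) (use U_min_less_max in auto)
    then show ?thesis using f2_limit by (simp add: continuous_within)
  qed
qed (fact refl DERIV_upper DERIV_f2 f1_neg f2_blowup DERIV_F1_lower DERIV_f1_lower lower_negative F1_min_pos)+

end

section \<open>From \<open>Omega_rev\<close> to profiles\<close>

lemma smooth_periodic_deriv:
  assumes "U \<in> smooth_periodic"
  shows "((deriv ^^ k) U has_real_derivative (deriv ^^ Suc k) U q) (at q)"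
proof -
  have "(deriv ^^ k) U differentiable_on UNIV" using assms unfolding smooth_periodic_def by blast
  then have "(deriv ^^ k) U differentiable (at q)" by (simp add: differentiable_on_def)
  then obtain d where "((deriv ^^ k) U has_real_derivative d) (at q)" by (auto simp: real_differentiable_def)
  then show ?thesis using DERIV_imp_deriv by force
qed

lemma smooth_periodic_Cdiff: "U \<in> smooth_periodic \<Longrightarrow> Cdiff n ((deriv ^^ k) U) UNIV"
proof (induction n arbitrary: k)
  case 0
  have "continuous_on UNIV ((deriv ^^ k) U)"
    by (rule DERIV_imp_continuous_on[OF smooth_periodic_deriv[OF 0]])
  then show ?case by simp
next
  case (Suc n)
  show ?case by (rule Cdiff_SucI[OF smooth_periodic_deriv[OF Suc.prems] Suc.IH[OF Suc.prems]])
qed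

lemma local_extremum_critical:
  assumes "(U has_real_derivative d) (at q)" "local_min U q \<or> local_max U q"
  shows "d = 0"
proof -
  obtain e where "e > 0" "(\<forall>x. dist x q < e \<longrightarrow> U q \<le> U x) \<or> (\<forall>x. dist x q < e \<longrightarrow> U x \<le> U q)"
    using assms(2) unfolding local_min_def local_max_def eventually_nhds_metric by blast
  then show ?thesis
    using DERIV_local_min[OF assms(1), of e] DERIV_local_max[OF assms(1), of e]
    by (auto simp: dist_real_def abs_minus_commute)
qed

text \<open>The inequality is strict so that it contradicts a local maximum at the same point; this
  fixes the sign of the second derivative at each extremum.\<close>

lemma second_derivative_test:
  assumes d: "\<And>x. (U has_real_derivative U1 x) (at x)" "(U1 has_real_derivative d2) (at q)" "U1 q = 0"
    and "d2 > 0"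
  shows "\<exists>e>0. \<forall>x. x \<noteq> q \<longrightarrow> \<bar>x - q\<bar> < e \<longrightarrow> U q < U x"
proof -
  obtain e1 where e1: "e1 > 0" "\<And>h. 0 < h \<Longrightarrow> h < e1 \<Longrightarrow> U1 q < U1 (q + h)"
    using DERIV_pos_inc_right[OF d(2) assms(4)] by blast
  obtain e2 where e2: "e2 > 0" "\<And>h. 0 < h \<Longrightarrow> h < e2 \<Longrightarrow> U1 (q - h) < U1 q"
    using DERIV_pos_inc_left[OF d(2) assms(4)] by blast
  have c: "continuous_on A U" for A by (meson DERIV_imp_continuous_on d(1))
  have "U q < U x" if "x \<noteq> q" "\<bar>x - q\<bar> < min e1 e2" for x
  proof (cases "x > q")
    case True
    show ?thesis
    proof (rule DERIV_pos_imp_increasing_open[where f = U, OF True _ c])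
      fix z assume "q < z" "z < x"
      then show "\<exists>y. (U has_real_derivative y) (at z) \<and> 0 < y"
        using d(1)[of z] e1(2)[of "z - q"] d(3) that by (intro exI[of _ "U1 z"]) auto
    qed
  next
    case False
    then have "x < q" using that by simp
    then show ?thesis
    proof (rule DERIV_neg_imp_decreasing_open[where f = U, OF _ _ c])
      fix z assume "x < z" "z < q"
      then show "\<exists>y. (U has_real_derivative y) (at z) \<and> y < 0"
        using d(1)[of z] e2(2)[of "q - z"] d(3) that by (intro exI[of _ "U1 z"]) auto
    qed
  qed
  then show ?thesis using e1(1) e2(1) by (intro exI[of _ "min e1 e2"]) auto
qed

lemma local_min_shift:
  assumes "\<And>q. U (q + 1) = U q"
  shows "local_min U (q + of_int k) \<longleftrightarrow> local_min U q" "local_max U (q + of_int k) \<longleftrightarrow> local_max U q"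
proof -
  interpret U: periodic_fun_simple' U by unfold_locales (rule assms)
  have "nhds (q + of_int k) = filtermap (\<lambda>x. x + of_int k) (nhds q)"
    using filtermap_nhds_shift[of "- of_int k" q] by simp
  then show "local_min U (q + of_int k) \<longleftrightarrow> local_min U q" "local_max U (q + of_int k) \<longleftrightarrow> local_max U q"
    by (simp_all add: local_min_def local_max_def eventually_filtermap U.plus_of_int)
qed

lemma frac_eq_of_int: "(x::real) = frac x + of_int \<lfloor>x\<rfloor>"
  by (simp add: frac_def)

lemma continuous_nonzero_sign:
  fixes f :: "real \<Rightarrow> real"
  assumes "continuous_on {a<..<b} f" "\<And>x. x \<in> {a<..<b} \<Longrightarrow> f x \<noteq> 0" "z \<in> {a<..<b}" "f z > 0" "x \<in> {a<..<b}"
  shows "f x > 0"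
proof (rule ccontr)
  assume "\<not> f x > 0"
  then have neg: "f x \<le> 0" by simp
  have "connected (f ` {a<..<b})" by (rule connected_continuous_image[OF assms(1)]) (rule connected_Ioo)
  then have "0 \<in> f ` {a<..<b}"
    using connectedD_interval[of "f ` {a<..<b}" "f x" "f z" 0] assms(3-5) neg by auto
  then show False using assms(2) by auto
qed

text \<open>Nondegeneracy makes every critical point a local extremum, so modulo 1 the two given
  extrema are the only critical points. Between them \<open>U'\<close> cannot change sign, and
  \<open>U''\<close> at the left end of each interval determines which sign it has.\<close>

lemma Omega_rev_profile:
  assumes "U \<in> Omega_rev"
  obtains m M where "profile U (deriv U) (deriv (deriv U)) m M"
proof -
  let ?U1 = "deriv U" and ?U2 = "deriv (deriv U)"
  have sp: "U \<in> smooth_periodic" and pos: "\<And>q. U q > 0"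
    and nd: "\<And>q. ?U1 q = 0 \<Longrightarrow> ?U2 q \<noteq> 0"
    using assms unfolding Omega_rev_def by auto
  have per: "\<And>q. U (q + 1) = U q" using sp by (simp add: smooth_periodic_def)
  have d1: "(U has_real_derivative ?U1 q) (at q)" for q
    using smooth_periodic_deriv[OF sp, of 0 q] by simp
  have d2: "(?U1 has_real_derivative ?U2 q) (at q)" for q
    using smooth_periodic_deriv[OF sp, of 1 q] by simp
  have smooth: "Cdiff n ?U2 UNIV" for n
    using smooth_periodic_Cdiff[OF sp, of n 2] by (simp add: numeral_2_eq_2)
  obtain m where m: "m \<in> {0..<1}" "local_min U m" "\<And>x. x \<in> {0..<1} \<Longrightarrow> local_min U x \<Longrightarrow> x = m"
    using assms unfolding Omega_rev_def by blast
  obtain N where N: "N \<in> {0..<1}" "local_max U N" "\<And>x. x \<in> {0..<1} \<Longrightarrow> local_max U x \<Longrightarrow> x = N"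
    using assms unfolding Omega_rev_def by blast
  note shift = local_min_shift[of U, OF per]
  have frac01: "frac x \<in> {0..<1}" for x :: real using frac_lt_1[of x] by simp
  have min_eq: "frac q = m" if "local_min U q" for q
    using m(3)[OF frac01] shift(1)[of "frac q" "\<lfloor>q\<rfloor>"] that by (simp flip: frac_eq_of_int)
  have max_eq: "frac q = N" if "local_max U q" for q
    using N(3)[OF frac01] shift(2)[of "frac q" "\<lfloor>q\<rfloor>"] that by (simp flip: frac_eq_of_int)
  have crit_min: "local_min U q" if q: "?U1 q = 0" "?U2 q > 0" for q
  proof -
    obtain e where "e > 0" "\<forall>x. x \<noteq> q \<longrightarrow> \<bar>x - q\<bar> < e \<longrightarrow> U q < U x"
      using second_derivative_test[OF d1 d2 q] by blast
    then show ?thesis unfolding local_min_def eventually_nhds_metric dist_real_def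
      by (intro exI[of _ e]) (metis less_eq_real_def)
  qed
  have crit_max: "\<exists>e>0. \<forall>x. x \<noteq> q \<longrightarrow> \<bar>x - q\<bar> < e \<longrightarrow> U x < U q" if "?U1 q = 0" "?U2 q < 0" for q
    using second_derivative_test[of "\<lambda>x. - U x" "\<lambda>x. - ?U1 x" "- ?U2 q" q] d1 d2 that
    by (auto intro!: derivative_intros)
  have crit_max': "local_max U q" if "?U1 q = 0" "?U2 q < 0" for q
    using crit_max[OF that] unfolding local_max_def eventually_nhds_metric dist_real_def
    by (metis less_eq_real_def)
  have Um: "?U1 m = 0" using local_extremum_critical[OF d1] m(2) by blast
  have UN: "?U1 N = 0" using local_extremum_critical[OF d1] N(2) by blast
  have U2m: "?U2 m > 0"
  proof (rule ccontr)
    assume "\<not> ?thesis"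
    then obtain e where e: "e > 0" "\<And>x. x \<noteq> m \<Longrightarrow> \<bar>x - m\<bar> < e \<Longrightarrow> U x < U m"
      using crit_max[OF Um] nd[OF Um] by force
    obtain d where d: "d > 0" "\<And>x. \<bar>x - m\<bar> < d \<Longrightarrow> U m \<le> U x"
      using m(2) unfolding local_min_def eventually_nhds_metric dist_real_def by blast
    obtain t where "0 < t" "t < d" "t < e" using field_lbound_gt_zero[OF d(1) e(1)] by blast
    then show False using e(2)[of "m + t"] d(2)[of "m + t"] by auto
  qed
  have U2N: "?U2 N < 0"
  proof (rule ccontr)
    assume "\<not> ?thesis"
    then obtain e where e: "e > 0" "\<And>x. x \<noteq> N \<Longrightarrow> \<bar>x - N\<bar> < e \<Longrightarrow> U N < U x"
      using second_derivative_test[OF d1 d2 UN] nd[OF UN] by force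
    obtain d where d: "d > 0" "\<And>x. \<bar>x - N\<bar> < d \<Longrightarrow> U x \<le> U N"
      using N(2) unfolding local_max_def eventually_nhds_metric dist_real_def by blast
    obtain t where "0 < t" "t < d" "t < e" using field_lbound_gt_zero[OF d(1) e(1)] by blast
    then show False using e(2)[of "N + t"] d(2)[of "N + t"] by auto
  qed
  have crit: "frac q = m \<or> frac q = N" if "?U1 q = 0" for q
    using nd[OF that] crit_min[OF that] crit_max'[OF that] min_eq max_eq
    by (metis linorder_neqE)
  have mN: "m \<noteq> N" using U2m U2N by auto
  \<comment> \<open>The representative of \<open>N\<close> modulo 1 that lies between
    \<open>m\<close> and \<open>m + 1\<close>.\<close>
  define M where "M = (if m < N then N else N + 1)"
  have order: "m < M" "M < m + 1" using m(1) N(1) mN by (auto simp: M_def)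
  have per1: "?U1 (q + 1) = ?U1 q" for q
  proof -
    have "((\<lambda>x. U (x + 1)) has_real_derivative ?U1 (q + 1)) (at q)"
      using DERIV_shift[of U "?U1 (q + 1)" q 1] d1 by simp
    then show ?thesis using DERIV_unique[OF _ d1] by (simp add: per)
  qed
  have per2: "?U2 (q + 1) = ?U2 q" for q
  proof -
    have "((\<lambda>x. ?U1 (x + 1)) has_real_derivative ?U2 (q + 1)) (at q)"
      using DERIV_shift[of ?U1 "?U2 (q + 1)" q 1] d2 by simp
    then show ?thesis using DERIV_unique[OF _ d2] by (simp add: per1)
  qed
  have UM: "?U1 M = 0" "?U2 M < 0" using UN U2N per1 per2 by (auto simp: M_def)
  have no_crit: "?U1 q \<noteq> 0" if q: "q \<in> {m<..<m + 1}" "q \<noteq> M" for q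
  proof
    assume "?U1 q = 0"
    then consider "frac q = m" | "frac q = N" using crit by blast
    moreover have "frac q = q \<or> frac q = q - 1"
    proof (cases "q < 1")
      case True
      then have "frac q = q" using q m(1) by (simp add: frac_eq)
      then show ?thesis ..
    next
      case False
      then have "\<lfloor>q\<rfloor> = 1" using q m(1) by (simp add: floor_unique)
      then show ?thesis by (simp add: frac_def)
    qed
    ultimately show False using q m(1) N(1) by cases (auto simp: M_def split: if_splits)
  qed
  have cont: "continuous_on A ?U1" for A by (meson DERIV_imp_continuous_on d2)
  have inc: "?U1 q > 0" if "q \<in> {m<..<M}" for q
  proof -
    obtain e where e: "e > 0" "\<And>h. 0 < h \<Longrightarrow> h < e \<Longrightarrow> ?U1 m < ?U1 (m + h)"
      using DERIV_pos_inc_right[OF d2 U2m] by blast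
    obtain h where h: "0 < h" "h < e" "m + h < M"
      using field_lbound_gt_zero[of e "M - m"] e(1) order by (auto simp: less_diff_eq add.commute)
    show ?thesis
      by (rule continuous_nonzero_sign[OF cont, where z = "m + h"])
         (use e(2)[OF h(1,2)] h order that no_crit Um in auto)
  qed
  have dec: "?U1 q < 0" if "q \<in> {M<..<m + 1}" for q
  proof -
    obtain e where e: "e > 0" "\<And>h. 0 < h \<Longrightarrow> h < e \<Longrightarrow> ?U1 M > ?U1 (M + h)"
      using DERIV_neg_dec_right[OF d2 UM(2)] by blast
    obtain h where h: "0 < h" "h < e" "M + h < m + 1"
      using field_lbound_gt_zero[of e "m + 1 - M"] e(1) order by (auto simp: less_diff_eq add.commute)
    have "- ?U1 q > 0"
      by (rule continuous_nonzero_sign[OF continuous_on_minus[OF cont], where z = "M + h"])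
         (use e(2)[OF h(1,2)] h order that no_crit UM in auto)
    then show ?thesis by simp
  qed
  have "profile U ?U1 ?U2 m M"
    by unfold_locales (use d1 d2 smooth per m(1) order UM inc dec U2m pos in auto)
  then show ?thesis by (rule that)
qed

theorem theorem4p1p5:
  shows "subtopology whitney_topology Omega_rev closure_of
           {U \<in> Omega_rev. nondegenerate_metric (revolution_metric U)} = Omega_rev"
proof
  show "subtopology whitney_topology Omega_rev closure_of
           {U \<in> Omega_rev. nondegenerate_metric (revolution_metric U)} \<subseteq> Omega_rev"
    using closure_of_subset_topspace[of "subtopology whitney_topology Omega_rev"] by auto
  show "Omega_rev \<subseteq> subtopology whitney_topology Omega_rev closure_of
           {U \<in> Omega_rev. nondegenerate_metric (revolution_metric U)}"
  proof
    fix U assume U: "U \<in> Omega_rev"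
    then have sp: "U \<in> smooth_periodic" by (simp add: Omega_rev_def)
    obtain m M where "profile U (deriv U) (deriv (deriv U)) m M" by (rule Omega_rev_profile[OF U])
    then interpret profile U "deriv U" "deriv (deriv U)" m M .
    interpret regular_F1 U f1 f2 "deriv f2" "U M" "U m" m M by (rule regular_F1)
    show "U \<in> subtopology whitney_topology Omega_rev closure_of
           {U \<in> Omega_rev. nondegenerate_metric (revolution_metric U)}"
      unfolding in_closure_of
    proof (intro conjI allI impI)
      show "U \<in> topspace (subtopology whitney_topology Omega_rev)" using U sp by simp
      fix T assume T: "U \<in> T \<and> openin (subtopology whitney_topology Omega_rev) T"
      then obtain S where S: "openin whitney_topology S" "T = S \<inter> Omega_rev"
        by (auto simp: openin_subtopology)
      then obtain n e where e: "e > 0" "\<And>W. W \<in> smooth_periodic \<Longrightarrow> Cn_near n e U W \<Longrightarrow> W \<in> S"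
        using T unfolding openin_whitney_topology by blast
      \<comment> \<open>The bound \<open>b < e\<close> gives nearness of every order, hence of the
        order \<open>n\<close> at hand.\<close>
      obtain b where b: "0 < b" "b < e" "b \<notin> bad_shifts"
        by (rule exists_positive_not_negligible[OF negligible_bad_shifts e(1)])
      let ?V = "\<lambda>q. U q + b"
      have V: "?V \<in> Omega_rev" by (rule Omega_rev_add_const[OF U b(1)])
      moreover have "?V \<in> S"
        by (rule e(2)[OF smooth_periodic_add_const[OF sp] Cn_near_add_const[OF sp b(1,2)]])
      moreover have "nondegenerate_metric (revolution_metric ?V)"
        by (rule nondegenerate_shift[OF b(1,3) refl V])
      ultimately show "\<exists>y. y \<in> {U \<in> Omega_rev. nondegenerate_metric (revolution_metric U)} \<and> y \<in> T"
        using S(2) by blast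
    qed
  qed
qed

end
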